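(* Let $q\ge 3$, $p\ge q$ be integers, $s\in\mathbb{N}$, and let $Y_s=\{y_i\}_{i=1}^{2s}$ be any collection of points with $y_{2s}<\cdots<y_1<y_{2s}+2\pi=:y_0$. For each sequence $\{\varepsilon_n\}_{n=1}^\infty$ of positive numbers tending to infinity, there is a function $f\in\Delta^{(q)}(Y_s)\cap W^p$ such that $$\limsup_{n\to\infty}\varepsilon_n n^{p-q+2}E_n^{(q)}(f,Y_s)=\infty.$$
   Context: A function $f\in C[a,b]$ is called $q$-monotone ($q\ge 2$) if $f\in C^{q-2}(a,b)$ and $f^{(q-2)}$ is convex on $(a,b)$. For $Y_s$ as in the claim, $\Delta^{(q)}(Y_s)$ denotes the set of continuous $2\pi$-periodic functions $f:\mathbb{R}\to\mathbb{R}$ such that $(-1)^{i-1}f$ is $q$-monotone on $[y_i,y_{i-1}]$ for each $1\le i\le 2s$. For $r\in\mathbb{N}$, $W^r$ denotes the class of $2\pi$-periodic functions $f$ with $f^{(r-1)}$ locally absolutely continuous on $\mathbb{R}$ and $\operatorname{ess\,sup}_{x\in\mathbb{R}}|f^{(r)}(x)|\le 2$. $\mathcal{T}_n$ is the space of real trigonometric polynomials of degree $\le n$. For a continuous $2\pi$-periodic $g$, $\|g\|=\max_{x\in\mathbb{R}}|g(x)|$, and $E_n^{(q)}(g,Y_s):=\inf_{T_n\in\mathcal{T}_n\cap\Delta^{(q)}(Y_s)}\|g-T_n\|$. *)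

theory Defs
  imports "HOL-Analysis.Analysis"
begin

definition C_k_on :: "nat \<Rightarrow> real set \<Rightarrow> (real \<Rightarrow> real) \<Rightarrow> bool" where
  "C_k_on k S f \<longleftrightarrow>
     (\<forall>j<k. \<forall>x\<in>S. (deriv ^^ j) f differentiable (at x)) \<and> continuous_on S ((deriv ^^ k) f)"

definition q_monotone_on :: "nat \<Rightarrow> real \<Rightarrow> real \<Rightarrow> (real \<Rightarrow> real) \<Rightarrow> bool" where
  "q_monotone_on q a b f \<longleftrightarrow>
     continuous_on {a..b} f \<and> C_k_on (q - 2) {a<..<b} f \<and>
     convex_on {a<..<b} ((deriv ^^ (q - 2)) f)"

definition periodic_2pi :: "(real \<Rightarrow> real) \<Rightarrow> bool" where
  "periodic_2pi f \<longleftrightarrow> (\<forall>x. f (x + 2 * pi) = f x)"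

(* \<Delta>^(q)(Y_s), with Y_s given by y 0, ..., y (2s) *)
definition Delta_q :: "nat \<Rightarrow> nat \<Rightarrow> (nat \<Rightarrow> real) \<Rightarrow> (real \<Rightarrow> real) set" where
  "Delta_q q s y = {f. continuous_on UNIV f \<and> periodic_2pi f \<and>
     (\<forall>i. 1 \<le> i \<and> i \<le> 2 * s \<longrightarrow> q_monotone_on q (y i) (y (i - 1)) (\<lambda>x. (-1) ^ (i - 1) * f x))}"

definition abs_cont_on :: "real \<Rightarrow> real \<Rightarrow> (real \<Rightarrow> real) \<Rightarrow> bool" where
  "abs_cont_on a b g \<longleftrightarrow>
     (\<forall>e>0. \<exists>d>0. \<forall>(n::nat) (u::nat \<Rightarrow> real) v.
        (\<forall>k<n. a \<le> u k \<and> u k \<le> v k \<and> v k \<le> b) \<and>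
        (\<forall>j<n. \<forall>k<n. j \<noteq> k \<longrightarrow> v j \<le> u k \<or> v k \<le> u j) \<and>
        (\<Sum>k<n. v k - u k) < d
        \<longrightarrow> (\<Sum>k<n. \<bar>g (v k) - g (u k)\<bar>) < e)"

definition W_class :: "nat \<Rightarrow> (real \<Rightarrow> real) set" where
  "W_class r = {f. periodic_2pi f \<and>
     (\<forall>j<r - 1. \<forall>x. (deriv ^^ j) f differentiable (at x)) \<and>
     (\<forall>a b. abs_cont_on a b ((deriv ^^ (r - 1)) f)) \<and>
     (AE x in lborel. (deriv ^^ (r - 1)) f differentiable (at x) \<and> \<bar>(deriv ^^ r) f x\<bar> \<le> 2)}"

definition trig_poly :: "nat \<Rightarrow> (real \<Rightarrow> real) set" where
  "trig_poly n = {T. \<exists>a0 (a::nat \<Rightarrow> real) (b::nat \<Rightarrow> real).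
      \<forall>x. T x = a0 + (\<Sum>k=1..n. a k * cos (real k * x) + b k * sin (real k * x))}"

definition sup_norm :: "(real \<Rightarrow> real) \<Rightarrow> real" where
  "sup_norm g = (SUP x. \<bar>g x\<bar>)"

definition E_q :: "nat \<Rightarrow> nat \<Rightarrow> (nat \<Rightarrow> real) \<Rightarrow> nat \<Rightarrow> (real \<Rightarrow> real) \<Rightarrow> real" where
  "E_q q s y n g = (INF T\<in>trig_poly n \<inter> Delta_q q s y. sup_norm (\<lambda>x. g x - T x))"

end

theory Submission
  imports Defs
begin

text \<open>
  Write \<open>z = y 1\<close> and \<open>d = p - q\<close>. If \<open>T\<close> is an admissible trigonometric polynomial of degree
  \<open>n\<close>, then \<open>P = T\<^sup>(\<^sup>q\<^sup>)\<close> changes sign at \<open>z\<close>, so \<open>(x - z) P x \<ge> 0\<close> near \<open>z\<close>; as \<open>P\<close> cannot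
  concentrate on a scale finer than \<open>1 / n\<close>, its local first moment about \<open>z\<close> is at least a
  multiple of \<open>1 / n\<close> times its local mass. On the other hand \<open>f\<^sup>(\<^sup>q\<^sup>)\<close> may carry next to \<open>z\<close> a bump
  of width \<open>h\<close>, a small multiple of \<open>1 / n\<close>, and height of order \<open>h ^ d\<close>, which has mass of order
  \<open>n ^ - (d + 1)\<close> but a much smaller first moment. Mass and first moment are tested against fixed
  polynomials vanishing at the ends of a neighbourhood of \<open>z\<close>, so that integration by parts turns
  the discrepancy into a lower bound of order \<open>n ^ - (d + 2)\<close> for the uniform distance of \<open>f\<close>
  and \<open>T\<close>. Bumps at rapidly decreasing scales are superposed; the bumps of the earlier scales vanish
  near \<open>z\<close> and only affect constants, which the growth of \<open>\<epsilon>\<close> absorbs. A bump of the opposite sign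
  inside \<open>(y 2, y 1)\<close> makes \<open>f\<^sup>(\<^sup>q\<^sup>)\<close> have mean zero.
\<close>

section \<open>Families of successive derivatives\<close>

text \<open>Carrying the derivatives as an explicit family makes differentiability part of the data;
  \<open>funpow_deriv_chain\<close> leads back to iterated \<open>deriv\<close>. Continuity of the
  top member \<open>u m\<close> is stated separately where it matters.\<close>

definition deriv_chain :: "nat \<Rightarrow> (nat \<Rightarrow> real \<Rightarrow> real) \<Rightarrow> bool" where
  "deriv_chain m u \<longleftrightarrow> (\<forall>j<m. \<forall>x. (u j has_real_derivative u (Suc j) x) (at x))"

lemma deriv_chainD:
  "deriv_chain m u \<Longrightarrow> j < m \<Longrightarrow> (u j has_real_derivative u (Suc j) x) (at x)"
  by (auto simp: deriv_chain_def)

lemma deriv_chain_mono: "deriv_chain m u \<Longrightarrow> j \<le> m \<Longrightarrow> deriv_chain j u"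
  by (auto simp: deriv_chain_def)

lemma funpow_deriv_chain:
  assumes "deriv_chain m u" "j \<le> m"
  shows "(deriv ^^ j) (u 0) = u j"
  using assms(2)
proof (induction j)
  case (Suc j)
  then show ?case
    using deriv_chainD[OF assms(1), of j] by (auto intro!: ext DERIV_imp_deriv)
qed simp

lemma deriv_chain_continuous_on:
  assumes "deriv_chain m u" "j < m"
  shows "continuous_on S (u j)"
  using deriv_chainD[OF assms] by (meson DERIV_isCont continuous_at_imp_continuous_on)

lemma deriv_chain_cmult:
  assumes "deriv_chain m u"
  shows "deriv_chain m (\<lambda>j x. c * u j x)"
  unfolding deriv_chain_def by (auto intro!: DERIV_cmult deriv_chainD[OF assms])

lemma deriv_chain_diff:
  assumes "deriv_chain m u" "deriv_chain m v"
  shows "deriv_chain m (\<lambda>j x. u j x - v j x)"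
  unfolding deriv_chain_def
  by (auto intro!: DERIV_diff deriv_chainD[OF assms(1)] deriv_chainD[OF assms(2)])

subsection \<open>Trigonometric polynomials\<close>

lemma trig_poly_deriv:
  assumes "T \<in> trig_poly n"
  shows "deriv T \<in> trig_poly n" "(T has_real_derivative deriv T x) (at x)"
proof -
  obtain a0 a b where T: "\<And>x. T x = a0 + (\<Sum>k=1..n. a k * cos (real k * x) + b k * sin (real k * x))"
    using assms by (auto simp: trig_poly_def)
  define T' where "T' = (\<lambda>x. 0 + (\<Sum>k=1..n. (b k * real k) * cos (real k * x) + (- a k * real k) * sin (real k * x)))"
  have T': "T' \<in> trig_poly n"
    unfolding trig_poly_def T'_def by (intro CollectI exI allI) (rule refl)
  have D: "(T has_real_derivative T' x) (at x)" for x
    unfolding T[abs_def] T'_def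
    by (rule derivative_eq_intros refl | simp)+ (auto intro!: sum.cong simp: algebra_simps)
  then have "deriv T = T'" by (auto intro!: ext DERIV_imp_deriv)
  with T' D show "deriv T \<in> trig_poly n" "(T has_real_derivative deriv T x) (at x)" by auto
qed

lemma trig_poly_funpow_deriv:
  assumes "T \<in> trig_poly n"
  shows "(deriv ^^ j) T \<in> trig_poly n"
  by (induction j) (auto simp: assms trig_poly_deriv)

lemma trig_poly_deriv_chain:
  assumes "T \<in> trig_poly n"
  shows "deriv_chain m (\<lambda>j. (deriv ^^ j) T)"
  unfolding deriv_chain_def using trig_poly_deriv[OF trig_poly_funpow_deriv[OF assms]] by simp

lemma trig_poly_continuous_on:
  assumes "T \<in> trig_poly n"
  shows "continuous_on S T"
  using trig_poly_deriv(2)[OF assms] by (meson DERIV_isCont continuous_at_imp_continuous_on)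

text \<open>Multiplication by \<open>cis (real n * x)\<close> moves the frequencies from [-n, n] to
  [0, 2n], so estimates for \<open>T\<close> become estimates for the coefficients of an algebraic
  polynomial on the unit circle.\<close>

lemma trig_poly_cis_poly:
  assumes "T \<in> trig_poly n"
  obtains t where "degree t \<le> 2 * n"
    "\<And>x. complex_of_real (T x) * cis (real n * x) = poly t (cis x)"
proof -
  obtain a0 a b where T: "\<And>x. T x = a0 + (\<Sum>k=1..n. a k * cos (real k * x) + b k * sin (real k * x))"
    using assms by (auto simp: trig_poly_def)
  define t where "t = monom (complex_of_real a0) n +
     (\<Sum>k=1..n. monom (Complex (a k / 2) (- b k / 2)) (n + k) + monom (Complex (a k / 2) (b k / 2)) (n - k))"
  have "degree t \<le> 2 * n"
    unfolding t_def
    by (intro degree_add_le degree_sum_le order.trans[OF degree_monom_le]) auto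
  moreover have "complex_of_real (T x) * cis (real n * x) = poly t (cis x)" for x
  proof -
    have e: "complex_of_real (a k * cos (real k * x) + b k * sin (real k * x)) * cis (real n * x) =
      poly (monom (Complex (a k / 2) (- b k / 2)) (n + k) + monom (Complex (a k / 2) (b k / 2)) (n - k)) (cis x)"
      if "k \<in> {1..n}" for k
    proof -
      have "real (n - k) * x = real n * x - real k * x" "real (n + k) * x = real n * x + real k * x"
        using that by (auto simp: of_nat_diff algebra_simps)
      then have 1: "cis x ^ (n - k) = cis (real n * x) * cis (- (real k * x))"
        "cis x ^ (n + k) = cis (real n * x) * cis (real k * x)"
        by (simp_all only: Complex.DeMoivre cis_mult) simp
      have 2: "complex_of_real (a k * cos (real k * x) + b k * sin (real k * x)) =
         Complex (a k / 2) (- b k / 2) * cis (real k * x) + Complex (a k / 2) (b k / 2) * cis (- (real k * x))"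
        by (simp add: complex_eq_iff field_simps)
      show ?thesis
        unfolding 2 by (simp only: poly_add poly_monom 1 distrib_right) (simp only: mult_ac)
    qed
    have "complex_of_real (T x) * cis (real n * x) = complex_of_real a0 * cis (real n * x) +
       (\<Sum>k=1..n. complex_of_real (a k * cos (real k * x) + b k * sin (real k * x)) * cis (real n * x))"
      by (simp add: T distrib_right sum_distrib_right)
    also have "\<dots> = poly t (cis x)"
      unfolding t_def poly_add poly_sum poly_monom Complex.DeMoivre
      using e by (intro arg_cong2[of _ _ _ _ plus] sum.cong) (auto simp: poly_monom Complex.DeMoivre)
    finally show ?thesis .
  qed
  ultimately show thesis using that by blast
qed

lemma has_vector_derivative_cis:
  "((\<lambda>x. cis (c * x)) has_vector_derivative \<i> * of_real c * cis (c * x)) (at x within S)"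
proof -
  have "((\<lambda>z. exp (\<i> * of_real c * z)) has_field_derivative \<i> * of_real c * exp (\<i> * of_real c * of_real x))
      (at (complex_of_real x))"
    by (auto intro!: derivative_eq_intros)
  from has_vector_derivative_real_field[OF this, of S] show ?thesis
    by (simp add: cis_conv_exp mult.assoc)
qed

lemma integral_cis_period:
  fixes m :: int
  shows "((\<lambda>x. cis (of_int m * x)) has_integral (if m = 0 then 2 * of_real pi else 0)) {w - pi..w + pi}"
proof (cases "m = 0")
  case True
  have "((\<lambda>x. 1 :: complex) has_integral ((w + pi) - (w - pi)) *\<^sub>R 1) {w - pi..w + pi}"
    using has_integral_const_real[of "1::complex" "w - pi" "w + pi"] by simp
  then show ?thesis using True by (simp add: scaleR_conv_of_real)
next
  case False
  define F where "F = (\<lambda>x. cis (of_int m * x) / (\<i> * of_int m))"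
  have "((\<lambda>x. cis (of_int m * x)) has_integral (F (w + pi) - F (w - pi))) {w - pi..w + pi}"
  proof (rule fundamental_theorem_of_calculus)
    fix x
    show "(F has_vector_derivative cis (of_int m * x)) (at x within {w - pi..w + pi})"
      unfolding F_def
      by (rule has_vector_derivative_eq_rhs[OF has_vector_derivative_divide[OF has_vector_derivative_cis]])
         (use False in simp)
  qed (use pi_ge_zero in linarith)
  moreover have "F (w + pi) = F (w - pi)"
  proof -
    have "cis (of_int m * (w + pi)) = cis (of_int m * (w - pi) + 2 * pi * of_int m)"
      by (simp add: algebra_simps)
    also have "\<dots> = cis (of_int m * (w - pi))"
      by (simp flip: cis_mult)
    finally show ?thesis by (simp add: F_def)
  qed
  ultimately show ?thesis using False by simp
qed

text \<open>The k-th coefficient is a Fourier coefficient of \<open>poly t (cis x)\<close>, and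
  \<open>cis (- (real k * x))\<close> has modulus one. The period may be centred anywhere; the
  concentration argument takes it around \<open>z\<close>.\<close>

lemma coeff_le_integral:
  fixes t :: "complex poly"
  shows "cmod (coeff t k) \<le> integral {w - pi..w + pi} (\<lambda>x. cmod (poly t (cis x))) / (2 * pi)"
proof -
  let ?J = "{w - pi..w + pi}"
  have e: "poly t (cis x) * cis (- (real k * x)) = (\<Sum>i\<le>degree t. coeff t i * cis (of_int (int i - int k) * x))" for x
  proof -
    have "poly t (cis x) * cis (- (real k * x)) = (\<Sum>i\<le>degree t. coeff t i * (cis (real i * x) * cis (- (real k * x))))"
      by (simp add: poly_altdef sum_distrib_right Complex.DeMoivre mult.assoc)
    then show ?thesis by (simp add: cis_mult algebra_simps)
  qed
  have "((\<lambda>x. poly t (cis x) * cis (- (real k * x))) has_integral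
     (\<Sum>i\<le>degree t. coeff t i * (if int i - int k = 0 then 2 * of_real pi else 0))) ?J"
    unfolding e by (intro has_integral_sum has_integral_mult_right integral_cis_period) auto
  moreover have "(\<Sum>i\<le>degree t. coeff t i * (if int i - int k = 0 then 2 * of_real pi else 0)) =
       (\<Sum>i\<le>degree t. if i = k then coeff t i * (2 * of_real pi) else 0)"
    by (rule sum.cong) auto
  moreover have "\<dots> = coeff t k * (2 * of_real pi)"
    by (auto simp: coeff_eq_0)
  ultimately have I: "((\<lambda>x. poly t (cis x) * cis (- (real k * x))) has_integral coeff t k * (2 * of_real pi)) ?J"
    by simp
  have "cmod (coeff t k * (2 * of_real pi)) \<le> integral ?J (\<lambda>x. cmod (poly t (cis x)))"
    unfolding integral_unique[OF I, symmetric]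
  proof (rule integral_norm_bound_integral)
    show "(\<lambda>x. cmod (poly t (cis x))) integrable_on ?J"
      by (intro integrable_continuous_real continuous_intros)
  qed (use I in \<open>auto simp: norm_mult integrable_on_def\<close>)
  then show ?thesis by (simp add: norm_mult field_simps)
qed

lemma cmod_poly_cis_le_sum:
  "cmod (poly t (cis x)) \<le> (\<Sum>i\<le>degree t. cmod (coeff t i))"
  unfolding poly_altdef by (rule order.trans[OF norm_sum]) (simp add: norm_mult norm_power)

text \<open>There are at most \<open>N + 1\<close> coefficients, and each is bounded by the mean of
  the modulus over a period.\<close>

lemma nikolskii:
  fixes t :: "complex poly"
  assumes "degree t \<le> N"
  shows "cmod (poly t (cis x)) \<le> real (N + 1) * integral {w - pi..w + pi} (\<lambda>x. cmod (poly t (cis x))) / (2 * pi)"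
proof -
  let ?I = "integral {w - pi..w + pi} (\<lambda>x. cmod (poly t (cis x))) / (2 * pi)"
  have "cmod (poly t (cis x)) \<le> (\<Sum>i\<le>degree t. ?I)"
    by (rule order.trans[OF cmod_poly_cis_le_sum]) (intro sum_mono coeff_le_integral)
  also have "\<dots> = real (degree t + 1) * ?I" by simp
  also have "\<dots> \<le> real (N + 1) * ?I"
  proof (rule mult_right_mono)
    show "0 \<le> ?I"
      by (intro divide_nonneg_nonneg integral_nonneg integrable_continuous_real continuous_intros) auto
  qed (use assms in simp)
  finally show ?thesis by simp
qed

text \<open>Up to 2n + 1 coefficients, each of modulus at most \<open>M\<close>, are differentiated
  one by one with a factor of at most \<open>n\<close>. The loss against the sharp factor
  \<open>n\<close> is harmless, since the bound will only be multiplied by an exponentially small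
  kernel value.\<close>

lemma bernstein_crude:
  assumes T: "T \<in> trig_poly n" and M: "\<And>x. \<bar>T x\<bar> \<le> M"
  shows "\<bar>deriv T x\<bar> \<le> real ((2 * n + 1) * n) * M"
proof -
  obtain t where deg: "degree t \<le> 2 * n"
    and t: "\<And>x. complex_of_real (T x) * cis (real n * x) = poly t (cis x)"
    using trig_poly_cis_poly[OF T] by blast
  have "M \<ge> 0" using M[of 0] by linarith
  have c: "cmod (coeff t k) \<le> M" for k
  proof -
    have "cmod (poly t (cis x)) \<le> M" for x
      unfolding t[symmetric] by (simp add: norm_mult M)
    then have "integral {0 - pi..0 + pi} (\<lambda>x. cmod (poly t (cis x))) \<le> integral {0 - pi..0 + pi} (\<lambda>x. M)"
      by (intro integral_le integrable_continuous_real continuous_intros) auto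
    also have "\<dots> = 2 * pi * M" by simp
    finally have "integral {0 - pi..0 + pi} (\<lambda>x. cmod (poly t (cis x))) / (2 * pi) \<le> M"
      by (simp add: divide_le_eq mult.commute)
    then show ?thesis using coeff_le_integral[of t k 0] by linarith
  qed
  have T_eq: "complex_of_real (T x) = (\<Sum>i\<le>degree t. coeff t i * cis (of_int (int i - int n) * x))" for x
  proof -
    have "complex_of_real (T x) = complex_of_real (T x) * cis (real n * x) * cis (- (real n * x))"
      by (simp add: mult.assoc cis_mult)
    also have "\<dots> = (\<Sum>i\<le>degree t. coeff t i * (cis (real i * x) * cis (- (real n * x))))"
      unfolding t by (simp add: poly_altdef sum_distrib_right Complex.DeMoivre mult.assoc)
    finally show ?thesis by (simp add: cis_mult algebra_simps)
  qed
  define D where "D = (\<Sum>i\<le>degree t. coeff t i * (\<i> * of_int (int i - int n) * cis (of_int (int i - int n) * x)))"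
  have "((\<lambda>x. complex_of_real (T x)) has_vector_derivative D) (at x)"
    unfolding T_eq D_def
  proof (intro has_vector_derivative_sum has_vector_derivative_mult_right)
    fix i
    show "((\<lambda>x. cis (of_int (int i - int n) * x)) has_vector_derivative
       \<i> * of_int (int i - int n) * cis (of_int (int i - int n) * x)) (at x)"
      by (rule has_vector_derivative_eq_rhs[OF has_vector_derivative_cis]) simp
  qed
  moreover have "((\<lambda>x. complex_of_real (T x)) has_vector_derivative of_real (deriv T x)) (at x)"
    using trig_poly_deriv(2)[OF T]
    by (intro has_vector_derivative_of_real) (simp add: has_real_derivative_iff_has_vector_derivative)
  ultimately have "complex_of_real (deriv T x) = D"
    using vector_derivative_unique_at by blast
  then have "\<bar>deriv T x\<bar> = cmod D" by (metis norm_of_real real_norm_def)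
  also have "\<dots> \<le> (\<Sum>i\<le>degree t. M * real n)"
    unfolding D_def
  proof (intro order.trans[OF norm_sum] sum_mono)
    fix i assume "i \<in> {..degree t}"
    then have "\<bar>int i - int n\<bar> \<le> int n" using deg by auto
    then have "\<bar>real_of_int (int i - int n)\<bar> \<le> real n" by linarith
    then show "cmod (coeff t i * (\<i> * of_int (int i - int n) * cis (of_int (int i - int n) * x))) \<le> M * real n"
      using \<open>M \<ge> 0\<close> unfolding norm_mult norm_of_int by (intro mult_mono c) auto
  qed
  also have "\<dots> \<le> real ((2 * n + 1) * n) * M"
  proof -
    have "real (degree t + 1) * (M * real n) \<le> real (2 * n + 1) * (M * real n)"
      using deg \<open>M \<ge> 0\<close> by (intro mult_right_mono) auto
    then show ?thesis by (simp add: algebra_simps)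
  qed
  finally show ?thesis .
qed

lemma bernstein_crude_funpow:
  assumes T: "T \<in> trig_poly n" and M: "\<And>x. \<bar>T x\<bar> \<le> M"
  shows "\<bar>(deriv ^^ j) T x\<bar> \<le> real ((2 * n + 1) * n) ^ j * M"
proof (induction j arbitrary: x)
  case (Suc j)
  show ?case
    using bernstein_crude[OF trig_poly_funpow_deriv[OF T] Suc.IH] by (simp add: mult.assoc)
qed (simp add: M)

subsection \<open>Integration by parts against polynomials vanishing at the endpoints\<close>

definition edge_poly :: "real \<Rightarrow> real \<Rightarrow> real poly" where
  "edge_poly a b = [:- a, 1:] * [:b, - 1:]"

lemma poly_edge_poly: "poly (edge_poly a b) x = (x - a) * (b - x)"
  by (simp add: edge_poly_def algebra_simps)

text \<open>Each differentiation costs at most one factor \<open>e\<close>. Once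
  \<open>m \<le> j\<close> the truncated difference is 0 and the divisor is 1.\<close>

lemma power_dvd_funpow_pderiv:
  fixes w :: "real poly"
  assumes "e ^ m dvd w"
  shows "e ^ (m - j) dvd (pderiv ^^ j) w"
proof (induction j)
  case (Suc j)
  show ?case
  proof (cases "m - j")
    case (Suc i)
    then obtain v where v: "(pderiv ^^ j) w = e ^ Suc i * v"
      using Suc.IH by (auto elim: dvdE)
    have "e ^ i dvd pderiv (e ^ Suc i * v)"
      unfolding pderiv_mult pderiv_power_Suc by (intro dvd_add) (auto simp: dvd_smult)
    moreover have "m - Suc j = i" using Suc by simp
    ultimately show ?thesis using v by simp
  qed simp
qed (use assms in simp)

lemma poly_funpow_pderiv_eq_0:
  assumes "edge_poly a b ^ m dvd w" "j < m" "x \<in> {a, b}"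
  shows "poly ((pderiv ^^ j) w) x = 0"
proof -
  have "edge_poly a b dvd edge_poly a b ^ (m - j)" using assms(2) by (simp add: dvd_power)
  then have "edge_poly a b dvd (pderiv ^^ j) w"
    using power_dvd_funpow_pderiv[OF assms(1)] dvd_trans by blast
  then show ?thesis using assms(3) by (auto elim!: dvdE simp: poly_edge_poly)
qed

text \<open>Each partial integration moves one derivative onto \<open>w\<close>. Boundary terms
  vanish because fewer than \<open>m\<close> differentiations leave a factor
  \<open>edge_poly a b\<close>.\<close>

lemma integral_poly_deriv_chain:
  assumes ab: "a \<le> b" and u: "deriv_chain m u" and cont: "continuous_on {a..b} (u m)"
    and w: "edge_poly a b ^ m dvd w" and "j \<le> m"
  shows "integral {a..b} (\<lambda>x. poly w x * u m x) =
    (-1) ^ j * integral {a..b} (\<lambda>x. poly ((pderiv ^^ j) w) x * u (m - j) x)"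
  using \<open>j \<le> m\<close>
proof (induction j)
  case (Suc j)
  define W where "W = (pderiv ^^ j) w"
  define i where "i = m - Suc j"
  have i: "m - j = Suc i" "i < m" using Suc.prems by (auto simp: i_def)
  have cu: "continuous_on {a..b} (u k)" if "k \<le> m" for k
    using that cont deriv_chain_continuous_on[OF u] by (cases "k = m") auto
  have W0: "poly W a = 0" "poly W b = 0"
    using poly_funpow_pderiv_eq_0[OF w, of j] Suc.prems by (auto simp: W_def)
  have "((\<lambda>x. poly W x * u (Suc i) x + poly (pderiv W) x * u i x) has_integral
      (poly W b * u i b - poly W a * u i a)) {a..b}"
  proof (rule fundamental_theorem_of_calculus[OF ab])
    fix x
    have "((\<lambda>x. poly W x * u i x) has_real_derivative (poly W x * u (Suc i) x + poly (pderiv W) x * u i x)) (at x)"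
      using DERIV_mult[OF poly_DERIV[of W x] deriv_chainD[OF u i(2), of x]] by (simp add: algebra_simps)
    then show "((\<lambda>x. poly W x * u i x) has_vector_derivative (poly W x * u (Suc i) x + poly (pderiv W) x * u i x))
        (at x within {a..b})"
      by (meson has_field_derivative_at_within has_real_derivative_iff_has_vector_derivative)
  qed
  then have "integral {a..b} (\<lambda>x. poly W x * u (Suc i) x + poly (pderiv W) x * u i x) = 0"
    using W0 by (simp add: integral_unique)
  moreover have "integral {a..b} (\<lambda>x. poly W x * u (Suc i) x + poly (pderiv W) x * u i x) =
     integral {a..b} (\<lambda>x. poly W x * u (Suc i) x) + integral {a..b} (\<lambda>x. poly (pderiv W) x * u i x)"
    using i by (intro integral_add integrable_continuous_real continuous_intros cu) auto
  ultimately have "integral {a..b} (\<lambda>x. poly W x * u (Suc i) x) =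
      - integral {a..b} (\<lambda>x. poly (pderiv W) x * u i x)"
    by linarith
  then show ?case
    using Suc.IH Suc.prems i by (simp add: W_def flip: i_def)
qed simp

text \<open>The constant is the L1 norm of the m-th derivative of \<open>w\<close>, hence the same
  for all \<open>u\<close>. Applied to \<open>f - T\<close>, this turns uniform closeness into
  closeness of weighted integrals of the q-th derivatives.\<close>

lemma integral_poly_deriv_chain_bound:
  assumes ab: "a \<le> b" and w: "edge_poly a b ^ m dvd w"
  shows "\<exists>A\<ge>0. \<forall>u E. deriv_chain m u \<longrightarrow> continuous_on {a..b} (u m) \<longrightarrow> (\<forall>x. \<bar>u 0 x\<bar> \<le> E) \<longrightarrow>
       \<bar>integral {a..b} (\<lambda>x. poly w x * u m x)\<bar> \<le> A * E"
proof (intro exI conjI allI impI)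
  let ?A = "integral {a..b} (\<lambda>x. \<bar>poly ((pderiv ^^ m) w) x\<bar>)"
  show "?A \<ge> 0" by (intro integral_nonneg integrable_continuous_real continuous_intros) auto
  fix u E
  assume u: "deriv_chain m u" and cont: "continuous_on {a..b} (u m)" and E: "\<forall>x. \<bar>u 0 x\<bar> \<le> E"
  have cu: "continuous_on {a..b} (u 0)"
    using cont deriv_chain_continuous_on[OF u] by (cases "m = 0") auto
  have "\<bar>integral {a..b} (\<lambda>x. poly w x * u m x)\<bar> =
      \<bar>integral {a..b} (\<lambda>x. poly ((pderiv ^^ m) w) x * u 0 x)\<bar>"
    using integral_poly_deriv_chain[OF ab u cont w order.refl] by (simp add: abs_mult power_abs)
  also have "\<dots> \<le> integral {a..b} (\<lambda>x. \<bar>poly ((pderiv ^^ m) w) x\<bar> * E)"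
    unfolding real_norm_def[symmetric]
    by (rule integral_norm_bound_integral)
       (auto intro!: integrable_continuous_real continuous_intros cu mult_left_mono E[rule_format] simp: abs_mult)
  finally show "\<bar>integral {a..b} (\<lambda>x. poly w x * u m x)\<bar> \<le> ?A * E" by simp
qed

subsection \<open>Concentration of sign-changing trigonometric polynomials\<close>

text \<open>A polynomial weight with zeros of order \<open>Suc q\<close> at \<open>z - r\<close> and
  \<open>z + r\<close>, so that \<open>q\<close> partial integrations leave no boundary
  terms.\<close>

definition cutoff :: "nat \<Rightarrow> real \<Rightarrow> real \<Rightarrow> real \<Rightarrow> real" where
  "cutoff q z r x = (1 - ((x - z) / r)\<^sup>2) ^ Suc q"

lemma cutoff_poly:
  assumes "r > 0"
  shows "cutoff q z r x = poly (smult ((1 / r\<^sup>2) ^ Suc q) (edge_poly (z - r) (z + r) ^ Suc q)) x"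
proof -
  have "1 - ((x - z) / r)\<^sup>2 = 1 / r\<^sup>2 * ((x - (z - r)) * (z + r - x))"
    using assms by (simp add: field_simps power2_eq_square)
  then show ?thesis unfolding cutoff_def poly_smult poly_power poly_edge_poly
    by (simp only: power_mult_distrib)
qed

lemma cutoff_bounds:
  assumes "r > 0" "x \<in> {z - r..z + r}"
  shows "0 \<le> cutoff q z r x" "cutoff q z r x \<le> 1"
proof -
  have "\<bar>(x - z) / r\<bar> \<le> 1" using assms by (auto simp: abs_le_iff field_simps)
  then have "((x - z) / r)\<^sup>2 \<le> 1" by (simp only: abs_square_le_1)
  then show "0 \<le> cutoff q z r x" "cutoff q z r x \<le> 1"
    unfolding cutoff_def by (auto intro!: zero_le_power power_le_one simp del: power_Suc)
qed

lemma cutoff_ge: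
  assumes "r > 0" "\<bar>x - z\<bar> \<le> r / 2"
  shows "(3/4) ^ Suc q \<le> cutoff q z r x"
proof -
  have "\<bar>(x - z) / r\<bar> \<le> 1 / 2" using assms by (simp add: field_simps)
  then have "\<bar>(x - z) / r\<bar>\<^sup>2 \<le> (1 / 2)\<^sup>2" by (intro power_mono) auto
  then have "((x - z) / r)\<^sup>2 \<le> 1 / 4" by (simp add: power2_eq_square)
  then show ?thesis unfolding cutoff_def by (intro power_mono) auto
qed

lemma cutoff_endpoints: "r > 0 \<Longrightarrow> x \<in> {z - r, z + r} \<Longrightarrow> cutoff q z r x = 0"
  by (auto simp: cutoff_def)

lemma continuous_on_cutoff [continuous_intros]: "r > 0 \<Longrightarrow> continuous_on S (cutoff q z r)"
  unfolding cutoff_def[abs_def] by (intro continuous_intros) auto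

text \<open>The kernel is a trigonometric polynomial of degree \<open>n\<close>, so
  \<open>\<bar>Q x\<bar>\<close> is the modulus of an algebraic polynomial of degree at most 4n on
  the circle.\<close>

lemma trig_poly_times_kernel_bound:
  fixes z :: real
  assumes P: "P \<in> trig_poly n"
  defines "Q \<equiv> \<lambda>x. P x * ((1 + cos (x - z)) / 2) ^ n"
  shows "\<bar>Q x\<bar> \<le> real (4 * n + 1) * integral {z - pi..z + pi} (\<lambda>x. \<bar>Q x\<bar>) / (2 * pi)"
proof -
  obtain t where deg: "degree t \<le> 2 * n"
    and t: "\<And>x. complex_of_real (P x) * cis (real n * x) = poly t (cis x)"
    using trig_poly_cis_poly[OF P] by blast
  define t' where "t' = t * (smult (1/4) ([:1, cis (- z):] ^ 2)) ^ n"
  have "degree (smult (1/4) ([:1, cis (- z):] ^ 2)) \<le> 2"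
    by (rule order.trans[OF degree_smult_le]) (rule order.trans[OF degree_power_le], simp)
  then have "degree ((smult (1/4) ([:1, cis (- z):] ^ 2)) ^ n) \<le> 2 * n"
    by (intro order.trans[OF degree_power_le]) auto
  then have deg': "degree t' \<le> 4 * n"
    unfolding t'_def using deg by (intro order.trans[OF degree_mult_le]) auto
  have eq: "cmod (poly t' (cis x)) = \<bar>Q x\<bar>" for x
  proof -
    \<comment> \<open>With y = x - z this is the half-angle identity: (1 + cos y) / 2 times
      \<open>cis y\<close> is the square of (1 + \<open>cis y\<close>) / 2. Each kernel factor thus
      has the modulus of a quadratic polynomial in \<open>cis x\<close>.\<close>
    have "cis (x - z) * ((1 + cos (x - z)) / 2) = 1/4 * (1 + cis (- z) * cis x)\<^sup>2"
    proof -
      have *: "Complex c s * of_real ((1 + c) / 2) = 1/4 * (1 + Complex c s)\<^sup>2" if "s * s = 1 - c * c" for c s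
        using that by (simp add: complex_eq_iff power2_eq_square field_simps)
      have "cis y * of_real ((1 + cos y) / 2) = 1/4 * (1 + cis y)\<^sup>2" for y
        unfolding cis.code by (rule *) (simp add: algebra_simps)
      moreover have "cis (- z) * cis x = cis (x - z)" by (simp add: cis_mult)
      ultimately show ?thesis by simp
    qed
    then have "cmod (1/4 * (1 + cis (- z) * cis x)\<^sup>2) = \<bar>(1 + cos (x - z)) / 2\<bar>"
      by (metis norm_cis norm_mult norm_of_real mult_1 real_norm_def)
    moreover have "cmod (poly t (cis x)) = \<bar>P x\<bar>"
      unfolding t[symmetric] by (simp add: norm_mult)
    moreover have "poly t' (cis x) = poly t (cis x) * (1/4 * (1 + cis (- z) * cis x)\<^sup>2) ^ n"
      by (simp add: t'_def mult.commute)
    ultimately show ?thesis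
      by (simp only: norm_mult norm_power Q_def abs_mult power_abs)
  qed
  show ?thesis using nikolskii[OF deg', of x z] by (simp add: eq)
qed

lemma cos_ge_quadratic: "1 - x\<^sup>2 / 2 \<le> cos (x::real)"
proof -
  have "\<bar>sin (x / 2)\<bar> \<le> \<bar>x / 2\<bar>" using abs_sin_x_le_abs_x by blast
  then have "(sin (x / 2))\<^sup>2 \<le> (x / 2)\<^sup>2" by (simp only: abs_le_square_iff)
  moreover have "cos x = 1 - 2 * (sin (x / 2))\<^sup>2" using cos_double_sin[of "x / 2"] by simp
  ultimately show ?thesis by (simp add: power2_eq_square)
qed

lemma one_plus_cos_nonneg: "0 \<le> 1 + cos (x::real)"
  using add_left_mono[OF cos_ge_minus_one[of x], of 1] by simp

text \<open>
  Multiplying by \<open>((1 + cos (x - z)) / 2) ^ n\<close> keeps the degree of order \<open>n\<close> and makes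
  everything at a fixed distance from \<open>z\<close> exponentially small; the Nikolskii inequality then
  forbids the product to carry its mass on an interval around \<open>z\<close> much shorter than \<open>1 / n\<close>.
\<close>

lemma local_concentration:
  fixes q :: nat
  assumes P: "P \<in> trig_poly n" and r: "0 < r" "r \<le> 1" and n: "8 / r \<le> real n"
    and pos: "\<And>x. z < x \<Longrightarrow> x < z + r \<Longrightarrow> 0 \<le> P x"
    and neg: "\<And>x. z - r < x \<Longrightarrow> x < z \<Longrightarrow> P x \<le> 0"
    and M: "\<And>x. \<bar>P x\<bar> \<le> M"
  defines "\<gamma> \<equiv> (3/4) ^ Suc q"
  shows "integral {z - r..z + r} (\<lambda>x. cutoff q z r x * P x) \<le>
     24 * real n / \<gamma> * integral {z - r..z + r} (\<lambda>x. (x - z) * cutoff q z r x * P x)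
       + pi * M * ((1 + cos (r / 2)) / 2) ^ n"
proof -
  let ?J = "{z - pi..z + pi}" and ?L = "{z - r..z + r}"
  \<comment> \<open>Since \<open>B\<close> will bound \<open>\<bar>P x * K x\<bar>\<close>, the
    window of half-width \<open>\<delta>\<close> carries at most 2 \<delta> B = I / 8 of the total
    mass \<open>I\<close>.\<close>
  define \<delta> where "\<delta> = 1 / (16 * real n)"
  let ?D = "{z - \<delta>..z + \<delta>}"
  define K where "K = (\<lambda>x. ((1 + cos (x - z)) / 2) ^ n)"
  define W where "W = (\<lambda>x. (x - z) * cutoff q z r x * P x)"
  define \<kappa> where "\<kappa> = ((1 + cos (r / 2)) / 2) ^ n"
  define I where "I = integral ?J (\<lambda>x. \<bar>P x * K x\<bar>)"
  define V where "V = integral ?L W"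
  define B where "B = real n * I"
  have \<gamma>: "0 < \<gamma>" "\<gamma> \<le> 1" unfolding \<gamma>_def by (auto simp del: power_Suc intro!: power_le_one)
  have "8 / r \<ge> 8" using r by (simp add: field_simps)
  then have n8: "real n \<ge> 8" using n by linarith
  have \<delta>: "0 < \<delta>" unfolding \<delta>_def using n8 by simp
  have "16 * real n * r \<ge> 2" using n r by (simp add: field_simps)
  then have \<delta>r: "\<delta> \<le> r / 2" unfolding \<delta>_def using n8 by (simp add: field_simps)
  have rpi: "r \<le> pi" using r pi_ge_two by linarith
  have "M \<ge> 0" using M[of 0] by linarith
  have cP: "continuous_on S P" for S using trig_poly_continuous_on[OF P] .
  have cK: "continuous_on S K" for S unfolding K_def by (intro continuous_intros) auto
  have cW: "continuous_on S W" for S unfolding W_def by (intro continuous_intros cP r)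
  have K01: "0 \<le> K x" "K x \<le> 1" for x
    unfolding K_def using one_plus_cos_nonneg[of "x - z"] by (auto intro!: power_le_one zero_le_power)
  have \<kappa>0: "0 \<le> \<kappa>"
    using K01(1)[of "z + r / 2"] by (simp add: K_def \<kappa>_def)
  have I0: "0 \<le> I" unfolding I_def by (intro integral_nonneg integrable_continuous_real continuous_intros cP cK) auto
  \<comment> \<open>The sign change of \<open>P\<close> at \<open>z\<close> makes the moment
    integrand an absolute value; at the two ends, where no sign is assumed, the cutoff
    vanishes.\<close>
  have WP: "W x = \<bar>x - z\<bar> * cutoff q z r x * \<bar>P x\<bar>" if xL: "x \<in> ?L" for x
  proof -
    consider "x = z" | "z < x \<and> x < z + r" | "z - r < x \<and> x < z" | "x = z - r \<or> x = z + r"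
      using xL unfolding atLeastAtMost_iff by linarith
    then show ?thesis
      by cases (use pos[of x] neg[of x] cutoff_endpoints[OF r(1), of x] in \<open>auto simp: W_def algebra_simps\<close>)
  qed
  have W0: "0 \<le> W x" if "x \<in> ?L" for x
    using WP[OF that] cutoff_bounds(1)[OF r(1) that] by simp
  have QB: "\<bar>P x * K x\<bar> \<le> B" for x
  proof -
    have "\<bar>P x * K x\<bar> \<le> real (4 * n + 1) * I / (2 * pi)"
      using trig_poly_times_kernel_bound[OF P, of x z] by (simp add: I_def K_def)
    also have "\<dots> \<le> B"
    proof -
      have "real (4 * n + 1) \<le> real n * (2 * pi)"
        using n8 pi_gt3 mult_left_mono[of 6 "2 * pi" "real n"] by linarith
      then have "real (4 * n + 1) / (2 * pi) \<le> real n" by (simp add: divide_le_eq)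
      then show ?thesis unfolding B_def using mult_right_mono[OF _ I0] by fastforce
    qed
    finally show ?thesis .
  qed
  have hD: "((\<lambda>x. if x \<in> ?D then c else 0) has_integral 2 * \<delta> * c) S" if "?D \<subseteq> S" for S and c :: real
    using has_integral_const_real[of c "z - \<delta>" "z + \<delta>"] \<delta> by (subst has_integral_restrict[OF that]) simp
  have hW: "(W has_integral V) ?L"
    unfolding V_def by (intro integrable_integral integrable_continuous_real cW)
  \<comment> \<open>The period is split in three. Within \<open>\<delta>\<close> of \<open>z\<close>
    the bound \<open>B\<close> applies; up to distance r / 2 the moment dominates, as \<bar>x -
    z\<bar> \<ge> \<delta> and the cutoff is at least \<open>\<gamma>\<close>; farther out the
    kernel is at most \<open>\<kappa>\<close>. The first contribution, I / 8, is then absorbed on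
    the left.\<close>
  have "I \<le> 2 * \<delta> * B + V / (\<delta> * \<gamma>) + 2 * pi * (M * \<kappa>)"
  proof (rule has_integral_le)
    show "((\<lambda>x. \<bar>P x * K x\<bar>) has_integral I) ?J"
      unfolding I_def by (intro integrable_integral integrable_continuous_real continuous_intros cP cK)
    have "((\<lambda>x. if x \<in> ?L then W x / (\<delta> * \<gamma>) else 0) has_integral V / (\<delta> * \<gamma>)) ?J"
      using has_integral_divide[OF hW] rpi by (subst has_integral_restrict) auto
    moreover have "((\<lambda>x. M * \<kappa>) has_integral 2 * pi * (M * \<kappa>)) ?J"
      using has_integral_const_real[of "M * \<kappa>" "z - pi" "z + pi"] by simp
    moreover have "((\<lambda>x. if x \<in> ?D then B else 0) has_integral 2 * \<delta> * B) ?J"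
      by (rule hD) (use \<delta>r rpi r in auto)
    ultimately show "((\<lambda>x. (if x \<in> ?D then B else 0) + (if x \<in> ?L then W x / (\<delta> * \<gamma>) else 0) + M * \<kappa>)
        has_integral 2 * \<delta> * B + V / (\<delta> * \<gamma>) + 2 * pi * (M * \<kappa>)) ?J"
      by (intro has_integral_add)
    fix x assume x: "x \<in> ?J"
    have B0: "0 \<le> B" using QB[of x] by linarith
    have M\<kappa>: "0 \<le> M * \<kappa>" using \<open>M \<ge> 0\<close> \<kappa>0 by simp
    have W': "0 \<le> (if x \<in> ?L then W x / (\<delta> * \<gamma>) else 0)" using W0 \<delta> \<gamma> by auto
    consider "x \<in> ?D" | "x \<notin> ?D" "\<bar>x - z\<bar> \<le> r / 2" | "r / 2 < \<bar>x - z\<bar>" by linarith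
    then show "\<bar>P x * K x\<bar> \<le> (if x \<in> ?D then B else 0) + (if x \<in> ?L then W x / (\<delta> * \<gamma>) else 0) + M * \<kappa>"
    proof cases
      case 1
      then show ?thesis using QB[of x] W' M\<kappa> by simp
    next
      case 2
      then have xL: "x \<in> ?L" using r unfolding atLeastAtMost_iff by linarith
      have "\<delta> \<le> \<bar>x - z\<bar>" using 2 unfolding atLeastAtMost_iff by linarith
      then have "\<delta> * \<gamma> * \<bar>P x\<bar> \<le> W x"
        unfolding WP[OF xL] \<gamma>_def
        using cutoff_ge[OF r(1) 2(2)] \<delta> by (intro mult_right_mono mult_mono) auto
      then have "\<bar>P x\<bar> \<le> W x / (\<delta> * \<gamma>)" using \<delta> \<gamma> by (simp add: le_divide_eq mult_ac)
      moreover have "\<bar>P x * K x\<bar> \<le> \<bar>P x\<bar>"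
        using K01[of x] by (simp add: abs_mult mult_left_le)
      ultimately show ?thesis using xL B0 M\<kappa> by auto
    next
      case 3
      have "cos (x - z) \<le> cos (r / 2)"
        using cos_monotone_0_pi_le[of "r / 2" "\<bar>x - z\<bar>"] 3 x r by (auto simp: abs_le_iff)
      then have "K x \<le> \<kappa>"
        unfolding K_def \<kappa>_def using one_plus_cos_nonneg[of "x - z"] by (intro power_mono) auto
      then have "\<bar>P x * K x\<bar> \<le> M * \<kappa>"
        unfolding abs_mult using K01[of x] M[of x] by (intro mult_mono) auto
      then show ?thesis using W' B0 by auto
    qed
  qed
  moreover have "2 * \<delta> * B = I / 8" unfolding \<delta>_def B_def using n8 by simp
  ultimately have I_le: "I \<le> 8/7 * (V / (\<delta> * \<gamma>) + 2 * pi * (M * \<kappa>))" by simp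
  \<comment> \<open>Now the kernel is removed: near \<open>z\<close> it is at least 1/2, which costs
    a factor 2; elsewhere \<bar>x - z\<bar> \<ge> \<delta> lets the moment dominate the cut-off mass
    directly.\<close>
  have "integral ?L (\<lambda>x. cutoff q z r x * P x) \<le> 2 * \<delta> * (2 * B) + V / \<delta>"
  proof (rule has_integral_le)
    show "((\<lambda>x. cutoff q z r x * P x) has_integral integral ?L (\<lambda>x. cutoff q z r x * P x)) ?L"
      by (intro integrable_integral integrable_continuous_real continuous_intros cP r)
    have "((\<lambda>x. if x \<in> ?D then 2 * B else 0) has_integral 2 * \<delta> * (2 * B)) ?L"
      by (rule hD) (use \<delta>r r in auto)
    then show "((\<lambda>x. (if x \<in> ?D then 2 * B else 0) + W x / \<delta>) has_integral 2 * \<delta> * (2 * B) + V / \<delta>) ?L"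
      by (intro has_integral_add has_integral_divide hW)
    fix x assume x: "x \<in> ?L"
    have B0: "0 \<le> B" using QB[of x] by linarith
    have c: "0 \<le> cutoff q z r x" "cutoff q z r x \<le> 1" using cutoff_bounds[OF r(1) x] .
    have a: "cutoff q z r x * P x \<le> cutoff q z r x * \<bar>P x\<bar>" using c by (intro mult_left_mono) auto
    show "cutoff q z r x * P x \<le> (if x \<in> ?D then 2 * B else 0) + W x / \<delta>"
    proof (cases "x \<in> ?D")
      case True
      have "\<bar>x - z\<bar> \<le> \<delta>" using True unfolding atLeastAtMost_iff by linarith
      then have "(x - z)\<^sup>2 \<le> \<delta>\<^sup>2" by (metis abs_ge_zero power2_abs power_mono)
      also have "\<dots> \<le> 1 / real n"
        unfolding \<delta>_def using n8 by (simp add: field_simps power2_eq_square)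
      finally have d: "real n * (x - z)\<^sup>2 \<le> 1" using n8 by (simp add: field_simps)
      have "1 * (x - z)\<^sup>2 \<le> real n * (x - z)\<^sup>2" using n8 by (intro mult_right_mono) auto
      then have d1: "(x - z)\<^sup>2 \<le> 1" using d by linarith
      \<comment> \<open>Bernoulli's inequality keeps the n-th power bounded below because n (x -
        z)^2 \<le> 1 in this window.\<close>
      have "1 / 2 \<le> 1 + real n * (- ((x - z)\<^sup>2 / 4))" using d by simp
      also have "\<dots> \<le> (1 + (- ((x - z)\<^sup>2 / 4))) ^ n"
      proof (rule Bernoulli_inequality)
        show "- 1 \<le> - ((x - z)\<^sup>2 / 4)" using d1 by simp
      qed
      also have "\<dots> \<le> K x"
        unfolding K_def
      proof (rule power_mono)
        show "1 + - ((x - z)\<^sup>2 / 4) \<le> (1 + cos (x - z)) / 2" using cos_ge_quadratic[of "x - z"] by simp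
        show "0 \<le> 1 + - ((x - z)\<^sup>2 / 4)" using d1 by simp
      qed
      finally have "1 / 2 \<le> K x" .
      then have "\<bar>P x\<bar> * (1 / 2) \<le> \<bar>P x\<bar> * K x" by (intro mult_left_mono) auto
      then have "\<bar>P x\<bar> \<le> 2 * B" using QB[of x] K01[of x] by (simp add: abs_mult)
      moreover have "cutoff q z r x * \<bar>P x\<bar> \<le> \<bar>P x\<bar>" using c by (simp add: mult_left_le_one_le)
      moreover have "0 \<le> W x / \<delta>" using W0[OF x] \<delta> by simp
      ultimately show ?thesis using a True by simp
    next
      case False
      then have "\<delta> \<le> \<bar>x - z\<bar>" unfolding atLeastAtMost_iff by linarith
      then have "\<delta> * (cutoff q z r x * \<bar>P x\<bar>) \<le> \<bar>x - z\<bar> * (cutoff q z r x * \<bar>P x\<bar>)"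
        using c by (intro mult_right_mono) auto
      also have "\<dots> = W x" using WP[OF x] by simp
      finally have "cutoff q z r x * \<bar>P x\<bar> \<le> W x / \<delta>" using \<delta> by (simp add: le_divide_eq mult_ac)
      then show ?thesis using a unfolding if_not_P[OF False] by linarith
    qed
  qed
  also have "2 * \<delta> * (2 * B) = I / 4" unfolding \<delta>_def B_def using n8 by simp
  also have "I / 4 + V / \<delta> \<le> 2/7 * (V / (\<delta> * \<gamma>) + 2 * pi * (M * \<kappa>)) + V / \<delta>"
    using I_le by simp
  \<comment> \<open>As \<gamma> \<le> 1, both moment terms are multiples of 16 n V / \<gamma>, with
    total factor at most 1 + 2/7 < 3/2; the remainder has factor 4/7 < 1.\<close>
  also have "\<dots> \<le> 24 * real n / \<gamma> * V + pi * M * \<kappa>"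
  proof -
    have V0: "0 \<le> V" unfolding V_def by (intro integral_nonneg integrable_continuous_real cW W0)
    have e: "V / (\<delta> * \<gamma>) = 16 * real n * V / \<gamma>" "V / \<delta> = 16 * real n * V" by (auto simp: \<delta>_def)
    have "16 * real n * V \<le> 16 * real n * V / \<gamma>"
      using \<gamma> V0 by (simp add: le_divide_eq mult_left_le)
    moreover have "0 \<le> 16 * real n * V / \<gamma>" using V0 \<gamma> by simp
    moreover have "0 \<le> pi * (M * \<kappa>)" using \<open>M \<ge> 0\<close> \<kappa>0 by simp
    moreover have "24 * real n / \<gamma> * V = 3/2 * (16 * real n * V / \<gamma>)" by simp
    ultimately show ?thesis unfolding e by (simp add: algebra_simps)
  qed
  finally show ?thesis by (simp add: V_def W_def \<kappa>_def)
qed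

text \<open>Let G be the weighted mass of \<open>fs q\<close>. Up to errors \<open>A * E\<close>,
  the q-th derivative of \<open>T\<close> has mass at least G and first moment at most h G.
  Concentration bounds that mass by 24 n / \<gamma> times the moment, and for 48 n h \<le> \<gamma>
  the h G part is at most G / 2. The constant \<open>A\<close> is fixed before \<open>n\<close>,
  \<open>T\<close> and \<open>fs\<close>.\<close>

lemma local_lower_bound:
  fixes q :: nat and z r :: real
  assumes r: "0 < r" "r \<le> 1"
  defines "\<gamma> \<equiv> (3/4) ^ Suc q"
  obtains A where "A \<ge> 0"
    "\<And>n T fs h E M. \<lbrakk>T \<in> trig_poly n; 8 / r \<le> real n;
       \<And>x. z < x \<Longrightarrow> x < z + r \<Longrightarrow> 0 \<le> (deriv ^^ q) T x;
       \<And>x. z - r < x \<Longrightarrow> x < z \<Longrightarrow> (deriv ^^ q) T x \<le> 0;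
       deriv_chain q fs; continuous_on UNIV (fs q);
       \<And>x. x \<in> {z - r..z + r} \<Longrightarrow> 0 \<le> fs q x \<and> (x - z) * fs q x \<le> h * fs q x;
       48 * real n * h \<le> \<gamma>; \<And>x. \<bar>fs 0 x - T x\<bar> \<le> E; \<And>x. \<bar>fs 0 x\<bar> \<le> M\<rbrakk> \<Longrightarrow>
     integral {z - r..z + r} (\<lambda>x. cutoff q z r x * fs q x) \<le>
       50 * real n * A * E / \<gamma> + 8 * (3 * real n ^ 2) ^ q * ((1 + cos (r / 2)) / 2) ^ n * (M + E)"
proof -
  let ?L = "{z - r..z + r}"
  define w where "w = smult ((1 / r\<^sup>2) ^ Suc q) (edge_poly (z - r) (z + r) ^ Suc q)"
  have w: "edge_poly (z - r) (z + r) ^ q dvd w"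
    unfolding w_def by (intro dvd_smult) (simp add: le_imp_power_dvd)
  have cw: "cutoff q z r x = poly w x" for x
    unfolding w_def using cutoff_poly[OF r(1)] .
  have rr: "z - r \<le> z + r" using r by simp
  obtain A0 where A0: "A0 \<ge> 0" "\<forall>u E. deriv_chain q u \<longrightarrow> continuous_on ?L (u q) \<longrightarrow> (\<forall>x. \<bar>u 0 x\<bar> \<le> E) \<longrightarrow>
       \<bar>integral ?L (\<lambda>x. poly w x * u q x)\<bar> \<le> A0 * E"
    using integral_poly_deriv_chain_bound[OF rr w] by blast
  \<comment> \<open>The test polynomial for the first moment.\<close>
  have w1: "edge_poly (z - r) (z + r) ^ q dvd [:- z, 1:] * w" using w by (rule dvd_mult)
  obtain A1 where A1: "A1 \<ge> 0" "\<forall>u E. deriv_chain q u \<longrightarrow> continuous_on ?L (u q) \<longrightarrow> (\<forall>x. \<bar>u 0 x\<bar> \<le> E) \<longrightarrow>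
       \<bar>integral ?L (\<lambda>x. poly ([:- z, 1:] * w) x * u q x)\<bar> \<le> A1 * E"
    using integral_poly_deriv_chain_bound[OF rr w1] by blast
  define A where "A = max A0 A1"
  have \<gamma>: "0 < \<gamma>" "\<gamma> \<le> 1" unfolding \<gamma>_def by (auto simp del: power_Suc intro!: power_le_one)
  show thesis
  proof (rule that)
    show "A \<ge> 0" unfolding A_def using A0 by simp
    fix n T fs h E M
    assume T: "T \<in> trig_poly n" and n: "8 / r \<le> real n"
      and pos: "\<And>x. z < x \<Longrightarrow> x < z + r \<Longrightarrow> 0 \<le> (deriv ^^ q) T x"
      and neg: "\<And>x. z - r < x \<Longrightarrow> x < z \<Longrightarrow> (deriv ^^ q) T x \<le> 0"
      and fs: "deriv_chain q fs" and cont: "continuous_on UNIV (fs q)"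
      and g: "\<And>x. x \<in> {z - r..z + r} \<Longrightarrow> 0 \<le> fs q x \<and> (x - z) * fs q x \<le> h * fs q x"
      and h: "48 * real n * h \<le> \<gamma>"
      and E: "\<And>x. \<bar>fs 0 x - T x\<bar> \<le> E" and M: "\<And>x. \<bar>fs 0 x\<bar> \<le> M"
    define P where "P = (deriv ^^ q) T"
    define G where "G = integral ?L (\<lambda>x. cutoff q z r x * fs q x)"
    define V where "V = integral ?L (\<lambda>x. (x - z) * cutoff q z r x * P x)"
    define \<kappa> where "\<kappa> = ((1 + cos (r / 2)) / 2) ^ n"
    have P: "P \<in> trig_poly n" unfolding P_def by (rule trig_poly_funpow_deriv[OF T])
    have cP: "continuous_on S P" for S using trig_poly_continuous_on[OF P] .
    have cg: "continuous_on S (fs q)" for S using cont continuous_on_subset by blast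
    have E0: "E \<ge> 0" using E[of 0] by linarith
    have M0: "M \<ge> 0" using M[of 0] by linarith
    define u where "u = (\<lambda>j x. fs j x - (deriv ^^ j) T x)"
    have u: "deriv_chain q u" unfolding u_def by (intro deriv_chain_diff fs trig_poly_deriv_chain[OF T])
    have uc: "continuous_on ?L (u q)" unfolding u_def P_def[symmetric] by (intro continuous_intros cP cg)
    have u0: "\<bar>u 0 x\<bar> \<le> E" for x using E by (simp add: u_def)
    have AE: "A0 * E \<le> A * E" "A1 * E \<le> A * E" unfolding A_def using E0 by (auto intro: mult_right_mono)
    have "8 / r \<ge> 8" using r by (simp add: field_simps)
    then have n8: "real n \<ge> 8" using n by linarith
    have "integral ?L (\<lambda>x. poly w x * u q x) = G - integral ?L (\<lambda>x. cutoff q z r x * P x)"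
      unfolding G_def cw[symmetric] u_def P_def[symmetric] right_diff_distrib
      by (intro integral_diff integrable_continuous_real continuous_intros cg cP r)
    then have 1: "G - A * E \<le> integral ?L (\<lambda>x. cutoff q z r x * P x)"
      using A0(2)[rule_format, OF u uc u0] AE by linarith
    have "integral ?L (\<lambda>x. poly ([:- z, 1:] * w) x * u q x) =
        integral ?L (\<lambda>x. (x - z) * cutoff q z r x * fs q x - (x - z) * cutoff q z r x * P x)"
      unfolding u_def P_def[symmetric] poly_mult cw by (simp add: algebra_simps)
    also have "\<dots> = integral ?L (\<lambda>x. (x - z) * cutoff q z r x * fs q x) - V"
      unfolding V_def by (intro integral_diff integrable_continuous_real continuous_intros cg cP r)
    finally have 2: "V \<le> integral ?L (\<lambda>x. (x - z) * cutoff q z r x * fs q x) + A * E"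
      using A1(2)[rule_format, OF u uc u0] AE by linarith
    have "integral ?L (\<lambda>x. (x - z) * cutoff q z r x * fs q x) \<le> integral ?L (\<lambda>x. h * (cutoff q z r x * fs q x))"
    proof (rule integral_le)
      fix x assume x: "x \<in> ?L"
      have "cutoff q z r x * ((x - z) * fs q x) \<le> cutoff q z r x * (h * fs q x)"
        using g[OF x] cutoff_bounds[OF r(1) x] by (intro mult_left_mono) auto
      then show "(x - z) * cutoff q z r x * fs q x \<le> h * (cutoff q z r x * fs q x)"
        by (simp add: mult_ac)
    qed (intro integrable_continuous_real continuous_intros cg r)+
    then have 3: "V \<le> h * G + A * E" using 2 by (simp add: G_def)
    have G0: "0 \<le> G" unfolding G_def
      using g cutoff_bounds[OF r(1)]
      by (intro integral_nonneg integrable_continuous_real continuous_intros cg r) auto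
    \<comment> \<open>A bound for \<open>P\<close> from the crude Bernstein inequality:
      \<bar>T\<bar> \<le> M + E and (2n + 1) n \<le> 3 n^2.\<close>
    define N where "N = (3 * real n ^ 2) ^ q * (M + E)"
    have PM: "\<bar>P x\<bar> \<le> N" for x
    proof -
      have "\<bar>T x\<bar> \<le> M + E" for x using E[of x] M[of x] by linarith
      then have "\<bar>P x\<bar> \<le> real ((2 * n + 1) * n) ^ q * (M + E)"
        unfolding P_def by (rule bernstein_crude_funpow[OF T])
      also have "\<dots> \<le> N"
      proof -
        have "real n * 1 \<le> real n * real n" using n8 by (intro mult_left_mono) auto
        then have "real ((2 * n + 1) * n) \<le> 3 * real n ^ 2"
          by (simp add: power2_eq_square algebra_simps)
        then show ?thesis unfolding N_def using M0 E0 by (intro mult_right_mono power_mono) auto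
      qed
      finally show ?thesis .
    qed
    have "integral ?L (\<lambda>x. cutoff q z r x * P x) \<le> 24 * real n / \<gamma> * V + pi * N * \<kappa>"
      unfolding V_def \<kappa>_def \<gamma>_def
      by (rule local_concentration[OF P r n]) (use pos neg PM in \<open>auto simp: P_def\<close>)
    also have "\<dots> \<le> 24 * real n / \<gamma> * (h * G + A * E) + 4 * N * \<kappa>"
    proof -
      have N0: "0 \<le> N" using PM[of 0] by linarith
      have "0 \<le> \<kappa>" unfolding \<kappa>_def using one_plus_cos_nonneg[of "r / 2"] by (intro zero_le_power) simp
      then have "pi * (N * \<kappa>) \<le> 4 * (N * \<kappa>)" using pi_less_4 N0 by (intro mult_right_mono) auto
      then show ?thesis using mult_left_mono[OF 3, of "24 * real n / \<gamma>"] \<gamma> by simp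
    qed
    finally have 4: "G - A * E \<le> 24 * real n / \<gamma> * (h * G) + 24 * real n / \<gamma> * (A * E) + 4 * N * \<kappa>"
      using 1 unfolding distrib_left by linarith
    have "24 * real n / \<gamma> * h \<le> 1 / 2" using h \<gamma> by (simp add: divide_le_eq)
    from mult_right_mono[OF this G0] have 5: "24 * real n / \<gamma> * (h * G) \<le> G / 2" by simp
    \<comment> \<open>Enlarging the error of the mass comparison by the factor n / \<gamma> lets it
      join the error of the moment comparison: 24 + 1 = 25, doubled to 50 after G / 2 has been moved
      to the left.\<close>
    have 6: "A * E \<le> real n / \<gamma> * (A * E)"
    proof -
      have "1 \<le> real n / \<gamma>" using \<gamma> n8 by (simp add: le_divide_eq)
      moreover have "0 \<le> A * E" using A0(1) E0 by (simp add: A_def)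
      ultimately show ?thesis using mult_right_mono by fastforce
    qed
    have 7: "24 * real n / \<gamma> * (A * E) = 24 * (real n / \<gamma> * (A * E))" by simp
    have "G / 2 \<le> 25 * X + N'" if "Y \<le> G / 2" "t \<le> X" "Z = 24 * X" "G - t \<le> Y + Z + N'" for X Y Z t N' :: real
      using that by linarith
    from this[OF 5 6 7 4] have "G / 2 \<le> 25 * (real n / \<gamma> * (A * E)) + 4 * N * \<kappa>" .
    then show "integral ?L (\<lambda>x. cutoff q z r x * fs q x) \<le>
       50 * real n * A * E / \<gamma> + 8 * (3 * real n ^ 2) ^ q * ((1 + cos (r / 2)) / 2) ^ n * (M + E)"
      unfolding G_def[symmetric] by (simp add: N_def \<kappa>_def algebra_simps)
  qed
qed

subsection \<open>q-monotonicity and the sign of the q-th derivative\<close>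

lemma q_monotone_on_if_deriv_chain:
  assumes u: "deriv_chain q u" and q: "q \<ge> 2" and nonneg: "\<And>x. a < x \<Longrightarrow> x < b \<Longrightarrow> 0 \<le> u q x"
  shows "q_monotone_on q a b (u 0)"
proof -
  have e: "(deriv ^^ j) (u 0) = u j" if "j \<le> q" for j
    using funpow_deriv_chain[OF u that] .
  have "C_k_on (q - 2) {a<..<b} (u 0)"
    unfolding C_k_on_def
  proof (intro conjI allI impI ballI)
    fix j x assume "j < q - 2"
    then have "j < q" by simp
    then show "(deriv ^^ j) (u 0) differentiable at x"
      using deriv_chainD[OF u, of j x] by (auto simp: e real_differentiable_def)
  next
    show "continuous_on {a<..<b} ((deriv ^^ (q - 2)) (u 0))"
      using q by (simp add: e deriv_chain_continuous_on[OF u])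
  qed
  moreover have "convex_on {a<..<b} (u (q - 2))"
  proof (rule f''_ge0_imp_convex)
    fix x assume "x \<in> {a<..<b}"
    have "Suc (q - 2) = q - 1" "Suc (q - 1) = q" using q by auto
    then show "(u (q - 2) has_real_derivative u (q - 1) x) (at x)"
      "(u (q - 1) has_real_derivative u q x) (at x)"
      using deriv_chainD[OF u, of "q - 2" x] deriv_chainD[OF u, of "q - 1" x] q by auto
  qed (use nonneg in auto)
  ultimately show ?thesis
    unfolding q_monotone_on_def using q deriv_chain_continuous_on[OF u, of 0] by (simp add: e)
qed

text \<open>Convexity of the derivative of order q - 2 makes the next derivative nondecreasing; a
  negative q-th derivative at a point would force a strict decrease just to its right.\<close>

lemma q_monotone_on_imp_deriv_nonneg:
  assumes u: "deriv_chain q u" and q: "q \<ge> 2" and mono: "q_monotone_on q a b (u 0)" and x: "a < x" "x < b"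
  shows "0 \<le> u q x"
proof -
  have ss: "Suc (q - 2) = q - 1" "Suc (q - 1) = q" using q by auto
  have conv: "convex_on {a<..<b} (u (q - 2))"
    using mono funpow_deriv_chain[OF u, of "q - 2"] by (simp add: q_monotone_on_def)
  have D1: "(u (q - 2) has_real_derivative u (q - 1) x) (at x)" for x
    using deriv_chainD[OF u, of "q - 2" x] ss q by simp
  have D2: "(u (q - 1) has_real_derivative u q x) (at x)" for x
    using deriv_chainD[OF u, of "q - 1" x] ss q by simp
  \<comment> \<open>The tangent inequalities at \<open>s\<close> and at \<open>t\<close> are
    added.\<close>
  have mono': "u (q - 1) s \<le> u (q - 1) t" if "s \<in> {a<..<b}" "t \<in> {a<..<b}" "s \<le> t" for s t
  proof -
    have "u (q - 2) t - u (q - 2) s \<ge> u (q - 1) s * (t - s)"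
      by (rule convex_on_imp_above_tangent[OF conv]) (use that D1 in \<open>auto intro: has_field_derivative_at_within\<close>)
    moreover have "u (q - 2) s - u (q - 2) t \<ge> u (q - 1) t * (s - t)"
      by (rule convex_on_imp_above_tangent[OF conv]) (use that D1 in \<open>auto intro: has_field_derivative_at_within\<close>)
    ultimately have "0 \<le> (u (q - 1) t - u (q - 1) s) * (t - s)" by (simp add: algebra_simps)
    then show ?thesis using that by (cases "s = t") (auto simp: zero_le_mult_iff)
  qed
  show ?thesis
  proof (rule ccontr)
    assume "\<not> 0 \<le> u q x"
    then have "u q x < 0" by simp
    from DERIV_neg_dec_right[OF D2 this]
    obtain d where d: "d > 0" "\<And>h. 0 < h \<Longrightarrow> h < d \<Longrightarrow> u (q - 1) (x + h) < u (q - 1) x"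
      by blast
    define h where "h = min (d / 2) ((b - x) / 2)"
    have h: "h \<le> d / 2" "h \<le> (b - x) / 2" unfolding h_def by (rule min.cobounded1 min.cobounded2)+
    have "0 < h" using d(1) x by (simp add: h_def)
    moreover have "h < d" using h d(1) by linarith
    moreover have "x + h < b" using h(2) x(2) by (simp add: field_simps)
    ultimately show False using d(2)[of h] mono'[of x "x + h"] x by simp
  qed
qed

text \<open>Provides an element of the set over which \<open>E_q\<close> takes its infimum.\<close>

lemma zero_in_Delta_q:
  assumes "q \<ge> 2"
  shows "(\<lambda>x. 0) \<in> Delta_q q s y"
proof -
  have "q_monotone_on q a b (\<lambda>x. 0)" for a b
    by (rule q_monotone_on_if_deriv_chain[of q "\<lambda>j x. 0", OF _ assms]) (auto simp: deriv_chain_def)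
  then show ?thesis by (simp add: Delta_q_def periodic_2pi_def)
qed

lemma zero_in_trig_poly: "(\<lambda>x. 0) \<in> trig_poly n"
  unfolding trig_poly_def by (intro CollectI exI[of _ 0] exI[of _ "\<lambda>k. 0"]) simp

subsection \<open>Spline bumps\<close>

text \<open>The index \<open>j\<close> counts derivatives. Starting the support at 1/2 keeps a bump
  of scale h at distance h / 2 from its base point, which leaves room for all finer scales.\<close>

definition bump :: "nat \<Rightarrow> nat \<Rightarrow> real \<Rightarrow> real" where
  "bump d j x = (if 1/2 < x \<and> x < 1 then poly ((pderiv ^^ j) (edge_poly (1/2) 1 ^ (d + 2))) x else 0)"

lemma bump_outside: "x \<le> 1/2 \<or> 1 \<le> x \<Longrightarrow> bump d j x = 0"
  by (auto simp: bump_def)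

lemma bump_nonneg: "0 \<le> bump d 0 x"
  by (auto simp: bump_def poly_edge_poly intro!: mult_nonneg_nonneg zero_le_power)

text \<open>The zeros of order \<open>d + 2\<close> at 1/2 and 1 survive \<open>Suc j\<close>
  differentiations while \<open>j \<le> d\<close>, so the polynomial and the zero branch glue
  differentiably.\<close>

lemma bump_has_derivative:
  assumes "j \<le> d"
  shows "(bump d j has_real_derivative bump d (Suc j) x) (at x)"
proof -
  define w where "w = (pderiv ^^ j) (edge_poly (1/2) 1 ^ (d + 2))"
  have w0: "poly w x = 0" "poly (pderiv w) x = 0" if "x \<in> {1/2, 1}" for x
    using poly_funpow_pderiv_eq_0[of "1/2" 1 "d + 2" "edge_poly (1/2) 1 ^ (d + 2)" j x]
      poly_funpow_pderiv_eq_0[of "1/2" 1 "d + 2" "edge_poly (1/2) 1 ^ (d + 2)" "Suc j" x] that assms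
    by (auto simp: w_def)
  have b: "bump d j = (\<lambda>x. if x \<in> {1/2..1} then poly w x else 0)"
    using w0 by (fastforce simp: bump_def w_def)
  have b': "bump d (Suc j) x = (if x \<in> {1/2..1} then poly (pderiv w) x else 0)"
    using w0[of x] by (auto simp: bump_def w_def)
  have "((\<lambda>x. if x \<in> {1/2..1} then poly w x else 0) has_vector_derivative
      (if x \<in> {1/2..1} then poly (pderiv w) x else 0)) (at x within UNIV)"
  proof (rule has_vector_derivative_If_within_closures)
    show "(poly w has_vector_derivative poly (pderiv w) x) (at x within {1/2..1} \<union> closure {1/2..1} \<inter> closure (- {1/2..1}))"
      using poly_DERIV[of w x] by (meson has_field_derivative_at_within has_real_derivative_iff_has_vector_derivative)
    show "poly w x = 0" "poly (pderiv w) x = 0"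
      if "x \<in> closure {1/2..1}" "x \<in> closure (- {1/2..1::real})"
    proof -
      have "- {1/2..1::real} = {..<1/2} \<union> {1<..}" by auto
      then have "closure (- {1/2..1::real}) = {..1/2} \<union> {1..}" by (simp add: closure_Un)
      then have "x \<in> {1/2, 1}" using that by auto
      then show "poly w x = 0" "poly (pderiv w) x = 0" using w0 by auto
    qed
  qed (auto intro: derivative_intros)
  then show ?thesis unfolding b b' by (simp add: has_real_derivative_iff_has_vector_derivative)
qed

lemma bump_continuous_on:
  assumes "j \<le> d"
  shows "continuous_on S (bump d j)"
  using bump_has_derivative[OF assms] by (meson DERIV_isCont continuous_at_imp_continuous_on)

lemma bump_bounded: "\<exists>C>0. \<forall>j\<le>d. \<forall>x. \<bar>bump d j x\<bar> \<le> C"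
proof -
  have "\<exists>C. \<forall>x. \<bar>bump d j x\<bar> \<le> C" if "j \<le> d" for j
  proof -
    have "compact (bump d j ` {1/2..1})"
      by (intro compact_continuous_image bump_continuous_on that) auto
    then obtain C where C: "\<forall>x\<in>{1/2..1}. \<bar>bump d j x\<bar> \<le> C"
      using compact_imp_bounded bounded_iff by (metis image_eqI real_norm_def)
    have "\<bar>bump d j x\<bar> \<le> \<bar>C\<bar>" for x
    proof (cases "x \<in> {1/2..1}")
      case True
      then show ?thesis using C by (meson abs_ge_self order.trans)
    next
      case False
      then show ?thesis using bump_outside[of x d j] by auto
    qed
    then show ?thesis by blast
  qed
  then obtain C where C: "\<And>j x. j \<le> d \<Longrightarrow> \<bar>bump d j x\<bar> \<le> C j" by metis
  have "\<bar>bump d j x\<bar> \<le> 1 + (\<Sum>i\<le>d. \<bar>C i\<bar>)" if "j \<le> d" for j x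
  proof -
    have "\<bar>bump d j x\<bar> \<le> \<bar>C j\<bar>" using C[OF that, of x] by linarith
    also have "\<dots> \<le> (\<Sum>i\<le>d. \<bar>C i\<bar>)" using that by (intro member_le_sum) auto
    finally show ?thesis by simp
  qed
  moreover have "0 < 1 + (\<Sum>i\<le>d. \<bar>C i\<bar>)" by (intro add_pos_nonneg sum_nonneg) auto
  ultimately show ?thesis by blast
qed

lemma bump_scaled_has_derivative:
  assumes "j \<le> d" "h \<noteq> 0"
  shows "((\<lambda>x. c * bump d j ((x - z) / h)) has_real_derivative c / h * bump d (Suc j) ((x - z) / h)) (at x)"
proof -
  have "((\<lambda>x. bump d j ((x - z) / h)) has_real_derivative bump d (Suc j) ((x - z) / h) * (1 / h)) (at x)"
    by (rule DERIV_chain2[OF bump_has_derivative[OF assms(1)]]) (use assms(2) in \<open>auto intro!: derivative_eq_intros\<close>)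
  from DERIV_cmult[OF this, of c] show ?thesis by simp
qed

definition bump_mass :: "nat \<Rightarrow> real" where
  "bump_mass d = integral {0..1} (bump d 0)"

lemma bump_mass_pos: "0 < bump_mass d"
proof -
  have "0 \<noteq> bump_mass d"
  proof
    assume "0 = bump_mass d"
    then have "bump d 0 (3/4) = 0"
      unfolding bump_mass_def
      using integral_eq_0_iff[of 0 1 "bump d 0"] bump_continuous_on[of 0 d "{0..1}"] bump_nonneg by auto
    then show False by (simp add: bump_def poly_edge_poly)
  qed
  moreover have "0 \<le> bump_mass d"
    unfolding bump_mass_def
    by (intro integral_nonneg integrable_continuous_real bump_continuous_on bump_nonneg) auto
  ultimately show ?thesis by linarith
qed

lemma bump_scaled_has_integral:
  assumes "h > 0"
  shows "((\<lambda>x. bump d 0 ((x - z) / h)) has_integral h * bump_mass d) {z..z + h}"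
proof -
  have "(bump d 0 has_integral bump_mass d) {0..1}"
    unfolding bump_mass_def by (intro integrable_integral integrable_continuous_real bump_continuous_on) auto
  moreover have "h * (1 + z / h) = z + h"
    using assms by (simp add: field_simps)
  ultimately have "((\<lambda>x. bump d 0 (x / h - z / h)) has_integral h * bump_mass d) {z..z + h}"
    using has_integral_affinity'[of "bump d 0" "bump_mass d" 0 1 "1 / h" "- z / h"] assms
    by (simp add: mult.commute)
  then show ?thesis by (simp add: diff_divide_distrib)
qed

subsection \<open>Termwise differentiation\<close>

text \<open>One summable majorant for all orders up to \<open>m\<close> yields uniform convergence
  of every differentiated series.\<close>

lemma deriv_chain_suminf:
  fixes F :: "nat \<Rightarrow> nat \<Rightarrow> real \<Rightarrow> real"
  assumes F: "\<And>k. deriv_chain m (F k)" and cont: "\<And>k. continuous_on UNIV (F k m)"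
    and bound: "\<And>j k x. j \<le> m \<Longrightarrow> \<bar>F k j x\<bar> \<le> M k" and M: "summable M"
  shows "deriv_chain m (\<lambda>j x. \<Sum>k. F k j x)" "continuous_on UNIV (\<lambda>x. \<Sum>k. F k m x)"
proof -
  have unif: "uniformly_convergent_on UNIV (\<lambda>n x. \<Sum>k<n. F k j x)" if "j \<le> m" for j
    using bound[OF that] by (intro Weierstrass_m_test'[OF _ M]) auto
  show "deriv_chain m (\<lambda>j x. \<Sum>k. F k j x)"
    unfolding deriv_chain_def
  proof (intro allI impI)
    fix j x assume j: "j < m"
    show "((\<lambda>x. \<Sum>k. F k j x) has_real_derivative (\<Sum>k. F k (Suc j) x)) (at x)"
    proof (rule has_field_derivative_series'(2)[of UNIV])
      show "summable (\<lambda>k. F k j 0)"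
        using bound[of j _ 0] j by (intro summable_comparison_test'[OF M]) auto
    qed (use j deriv_chainD[OF F] unif in auto)
  qed
  have "uniform_limit UNIV (\<lambda>n x. \<Sum>k<n. F k m x) (\<lambda>x. \<Sum>k. F k m x) sequentially"
    using bound by (intro Weierstrass_m_test[OF _ M]) auto
  then show "continuous_on UNIV (\<lambda>x. \<Sum>k. F k m x)"
    by (rule uniform_limit_theorem[rotated]) (auto intro!: continuous_on_sum cont eventuallyI)
qed

subsection \<open>Periodisation\<close>

text \<open>The argument is first moved into [a, a + 2 pi), so only the values of \<open>F\<close>
  there count.\<close>

definition periodise :: "real \<Rightarrow> (real \<Rightarrow> real) \<Rightarrow> real \<Rightarrow> real" where
  "periodise a F x = F (x - 2 * pi * of_int \<lfloor>(x - a) / (2 * pi)\<rfloor>)"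

lemma periodise_periodic: "periodic_2pi (periodise a F)"
proof -
  have "\<lfloor>(x + 2 * pi - a) / (2 * pi)\<rfloor> = \<lfloor>(x - a) / (2 * pi)\<rfloor> + 1" for x
  proof -
    have "(x + 2 * pi - a) / (2 * pi) = (x - a) / (2 * pi) + 1" by (simp add: field_simps)
    then show ?thesis by simp
  qed
  then show ?thesis by (simp add: periodic_2pi_def periodise_def algebra_simps)
qed

lemma periodise_eq:
  assumes "a \<le> x" "x < a + 2 * pi"
  shows "periodise a F x = F x"
proof -
  have "\<lfloor>(x - a) / (2 * pi)\<rfloor> = 0" using assms by (intro floor_unique) (auto simp: field_simps)
  then show ?thesis by (simp add: periodise_def)
qed

text \<open>Since \<open>F\<close> vanishes near both ends of the period, the periodisation agrees
  with a single translate even across a seam. The shift is chosen before \<open>F\<close>, so that a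
  function and its derivative share it.\<close>

lemma periodise_local:
  assumes e: "0 < e" "e \<le> pi"
  shows "\<exists>c. \<forall>F y. (\<forall>t. t \<le> a + e \<or> a + 2 * pi - e \<le> t \<longrightarrow> F t = 0) \<longrightarrow> \<bar>y - x\<bar> < e \<longrightarrow> periodise a F y = F (y - c)"
proof (intro exI allI impI)
  define k where "k = \<lfloor>(x - a) / (2 * pi)\<rfloor>"
  fix F :: "real \<Rightarrow> real" and y
  assume F: "\<forall>t. t \<le> a + e \<or> a + 2 * pi - e \<le> t \<longrightarrow> F t = 0" and y: "\<bar>y - x\<bar> < e"
  have "of_int k \<le> (x - a) / (2 * pi)" "(x - a) / (2 * pi) < of_int k + 1"
    unfolding k_def by linarith+
  then have x: "a + 2 * pi * of_int k \<le> x" "x < a + 2 * pi * of_int k + 2 * pi"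
    by (auto simp: field_simps)
  define m where "m = \<lfloor>(y - a) / (2 * pi)\<rfloor>"
  have "of_int m \<le> (y - a) / (2 * pi)" "(y - a) / (2 * pi) < of_int m + 1"
    unfolding m_def by linarith+
  then have ym: "a + 2 * pi * of_int m \<le> y" "y < a + 2 * pi * of_int m + 2 * pi"
    by (auto simp: field_simps)
  have per: "periodise a F y = F (y - 2 * pi * of_int m)"
    by (simp add: periodise_def m_def)
  consider "m = k" | "m \<le> k - 1" | "m \<ge> k + 1" by linarith
  then show "periodise a F y = F (y - 2 * pi * of_int k)"
  proof cases
    case 1
    then show ?thesis using per by simp
  next
    case 2
    then have "of_int m + 1 \<le> (of_int k :: real)" by linarith
    then have "2 * pi * (of_int m + 1) \<le> 2 * pi * (of_int k :: real)" by (intro mult_left_mono) auto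
    then have "2 * pi * of_int m + 2 * pi \<le> 2 * pi * of_int k" by (simp add: algebra_simps)
    then have m1: "y - 2 * pi * of_int k \<le> a + e" "a + 2 * pi - e \<le> y - 2 * pi * of_int m"
      using ym x y e by linarith+
    show ?thesis unfolding per using F m1 by simp
  next
    case 3
    then have "of_int k + 1 \<le> (of_int m :: real)" by linarith
    then have "2 * pi * (of_int k + 1) \<le> 2 * pi * (of_int m :: real)" by (intro mult_left_mono) auto
    then have "2 * pi * of_int k + 2 * pi \<le> 2 * pi * of_int m" by (simp add: algebra_simps)
    then have m1: "a + 2 * pi - e \<le> y - 2 * pi * of_int k" "y - 2 * pi * of_int m \<le> a + e"
      using ym x y e by linarith+
    show ?thesis unfolding per using F m1 by simp
  qed
qed

lemma periodise_continuous_on: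
  assumes e: "0 < e" "e \<le> pi" and F: "\<And>t. t \<le> a + e \<or> a + 2 * pi - e \<le> t \<Longrightarrow> F t = 0"
    and cont: "continuous_on UNIV F"
  shows "continuous_on UNIV (periodise a F)"
proof (intro continuous_at_imp_continuous_on ballI)
  fix x
  obtain c where "\<forall>F y. (\<forall>t. t \<le> a + e \<or> a + 2 * pi - e \<le> t \<longrightarrow> F t = 0) \<longrightarrow> \<bar>y - x\<bar> < e \<longrightarrow> periodise a F y = F (y - c)"
    using periodise_local[OF e, of a x] by (elim exE) (erule that)
  note c = this[rule_format]
  have "continuous_on UNIV (\<lambda>y. F (y - c))"
    by (rule continuous_on_compose2[OF cont]) (auto intro!: continuous_intros)
  then have "isCont (\<lambda>y. F (y - c)) x"
    by (simp add: continuous_on_eq_continuous_at)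
  moreover have "\<forall>\<^sub>F y in nhds x. periodise a F y = F (y - c)"
    unfolding eventually_nhds_metric dist_real_def by (intro exI[of _ e] conjI e allI impI c) (use F in blast)
  ultimately show "isCont (periodise a F) x" by (simp add: isCont_cong)
qed

lemma periodise_deriv_chain:
  assumes e: "0 < e" "e \<le> pi" and F: "\<And>j t. j \<le> m \<Longrightarrow> t \<le> a + e \<or> a + 2 * pi - e \<le> t \<Longrightarrow> F j t = 0"
    and chain: "deriv_chain m F"
  shows "deriv_chain m (\<lambda>j. periodise a (F j))"
  unfolding deriv_chain_def
proof (intro allI impI)
  fix j x assume j: "j < m"
  obtain c where "\<forall>F y. (\<forall>t. t \<le> a + e \<or> a + 2 * pi - e \<le> t \<longrightarrow> F t = 0) \<longrightarrow> \<bar>y - x\<bar> < e \<longrightarrow> periodise a F y = F (y - c)"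
    using periodise_local[OF e, of a x] by (elim exE) (erule that)
  note c = this[rule_format]
  have "((\<lambda>y. F j (y - c)) has_real_derivative F (Suc j) (x - c)) (at x)"
    using DERIV_shift[of "F j" "F (Suc j) (x - c)" x "- c"] deriv_chainD[OF chain j] by simp
  moreover have "F (Suc j) (x - c) = periodise a (F (Suc j)) x"
    by (rule c[symmetric]) (use F[of "Suc j"] j e in auto)
  moreover have "\<forall>\<^sub>F y in nhds x. periodise a (F j) y = F j (y - c)"
    unfolding eventually_nhds_metric dist_real_def
    by (intro exI[of _ e] conjI e allI impI c) (use F[of j] j in simp)
  ultimately show "(periodise a (F j) has_real_derivative periodise a (F (Suc j)) x) (at x)"
    using DERIV_cong_ev[OF refl, of "periodise a (F j)" "\<lambda>y. F j (y - c)" x "F (Suc j) (x - c)"] by simp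
qed

subsection \<open>Periodic antiderivatives\<close>

lemma periodic_2pi_shift:
  assumes "periodic_2pi f"
  shows "f (x - 2 * pi * of_int k) = f x"
proof -
  have nat: "f (x + 2 * pi * real n) = f x" for x n
  proof (induction n)
    case (Suc n)
    have "f (x + 2 * pi * real (Suc n)) = f (x + 2 * pi * real n + 2 * pi)" by (simp add: algebra_simps)
    then show ?case using Suc assms by (simp add: periodic_2pi_def)
  qed simp
  show ?thesis
  proof (cases k rule: int_cases2)
    case (nonneg n)
    then show ?thesis using nat[of "x - 2 * pi * of_int k" n] by simp
  next
    case (nonpos n)
    then show ?thesis using nat[of x n] by simp
  qed
qed

lemma periodic_2pi_reduce:
  assumes "periodic_2pi f"
  obtains x' where "a \<le> x'" "x' < a + 2 * pi" "f x' = f x"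
proof
  define k where "k = \<lfloor>(x - a) / (2 * pi)\<rfloor>"
  have "of_int k \<le> (x - a) / (2 * pi)" "(x - a) / (2 * pi) < of_int k + 1"
    unfolding k_def by linarith+
  then show "a \<le> x - 2 * pi * of_int k" "x - 2 * pi * of_int k < a + 2 * pi"
    by (auto simp: field_simps)
  show "f (x - 2 * pi * of_int k) = f x" by (rule periodic_2pi_shift[OF assms])
qed

text \<open>Zero mean of \<open>g\<close> makes an antiderivative periodic; subtracting its own mean
  restores zero mean, so the construction can be repeated.\<close>

lemma periodic_antiderivative:
  assumes g: "continuous_on UNIV g" "periodic_2pi g" and mean: "integral {a..a + 2 * pi} g = 0"
    and M: "\<And>x. \<bar>g x\<bar> \<le> M"
  obtains G where "\<And>x. (G has_real_derivative g x) (at x)" "periodic_2pi G"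
    "integral {a..a + 2 * pi} G = 0" "\<And>x. \<bar>G x\<bar> \<le> 2 * pi * M"
proof -
  have "\<exists>H. \<forall>x. - \<infinity> < ereal x \<longrightarrow> ereal x < \<infinity> \<longrightarrow> (H has_vector_derivative g x) (at x)"
    using g(1) by (intro einterval_antiderivative) (auto simp: continuous_on_eq_continuous_at)
  then obtain H where H: "\<And>x. (H has_real_derivative g x) (at x)"
    by (auto simp: has_real_derivative_iff_has_vector_derivative)
  have cH: "continuous_on S H" for S
    using H by (meson DERIV_isCont continuous_at_imp_continuous_on)
  have le: "a \<le> a + 2 * pi" by simp
  \<comment> \<open>The increment over a period has derivative zero, and at \<open>a\<close> it
    equals the integral of \<open>g\<close> over a period.\<close>
  have perH: "H (x + 2 * pi) = H x" for x
  proof -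
    have "((\<lambda>x. H (x + 2 * pi) - H x) has_real_derivative 0) (at x)" for x
      using DERIV_diff[OF iffD1[OF DERIV_shift H[of "x + 2 * pi"]] H[of x]] g(2) by (simp add: periodic_2pi_def)
    then have "H (x + 2 * pi) - H x = H (a + 2 * pi) - H a"
      using DERIV_isconst_all[of "\<lambda>x. H (x + 2 * pi) - H x" x a] by blast
    also have "\<dots> = integral {a..a + 2 * pi} g"
      using H le by (intro integral_unique[symmetric] fundamental_theorem_of_calculus)
        (auto simp flip: has_real_derivative_iff_has_vector_derivative intro: has_field_derivative_at_within)
    finally show ?thesis using mean by simp
  qed
  define c where "c = integral {a..a + 2 * pi} H / (2 * pi)"
  define G where "G = (\<lambda>x. H x - c)"
  have perG: "periodic_2pi G" by (simp add: G_def periodic_2pi_def perH)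
  show thesis
  proof (rule that)
    show "(G has_real_derivative g x) (at x)" for x
      unfolding G_def using DERIV_diff[OF H[of x] DERIV_const[of c]] by simp
    show "periodic_2pi G" by (rule perG)
    have "integral {a..a + 2 * pi} G = integral {a..a + 2 * pi} H - integral {a..a + 2 * pi} (\<lambda>x. c)"
      unfolding G_def by (intro integral_diff integrable_continuous_real cH) auto
    then show "integral {a..a + 2 * pi} G = 0" by (simp add: c_def)
    fix x
    obtain x' where x': "a \<le> x'" "x' < a + 2 * pi" "G x' = G x"
      using periodic_2pi_reduce[OF perG] by blast
    \<comment> \<open>\<open>G x'\<close> is the mean of \<open>H x' - H t\<close> over a period of
      \<open>t\<close>, so bounding these differences suffices.\<close>
    have "\<bar>H x' - H t\<bar> \<le> 2 * pi * M" if t: "t \<in> {a..a + 2 * pi}" for t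
    proof -
      have "norm (H x' - H t) \<le> M * norm (x' - t)"
        by (rule field_differentiable_bound[of UNIV H g M]) (use H M in auto)
      also have "\<dots> \<le> M * (2 * pi)"
      proof (rule mult_left_mono)
        show "norm (x' - t) \<le> 2 * pi" using t x' by auto
        show "0 \<le> M" using M[of 0] by linarith
      qed
      finally show ?thesis by (simp add: mult.commute)
    qed
    then have "norm (integral (cbox a (a + 2 * pi)) (\<lambda>t. H x' - H t)) \<le> (2 * pi * M) * measure lborel (cbox a (a + 2 * pi))"
      using M[of 0] by (intro integrable_bound integrable_continuous continuous_intros cH) auto
    moreover have "integral {a..a + 2 * pi} (\<lambda>t. H x' - H t) = integral {a..a + 2 * pi} (\<lambda>t. H x') - integral {a..a + 2 * pi} H"
      by (intro integral_diff integrable_continuous_real cH) auto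
    moreover have "\<dots> = 2 * pi * G x'" by (simp add: G_def c_def algebra_simps)
    ultimately have "\<bar>2 * pi * G x'\<bar> \<le> (2 * pi * M) * (2 * pi)" by simp
    then have "2 * pi * \<bar>G x'\<bar> \<le> 2 * pi * (2 * pi * M)" by (simp add: abs_mult mult_ac)
    then have "\<bar>G x'\<bar> \<le> 2 * pi * M" by (rule mult_left_le_imp_le) simp
    then show "\<bar>G x\<bar> \<le> 2 * pi * M" using x' by simp
  qed
qed

lemma periodic_iterated_antiderivative:
  assumes "continuous_on UNIV g" "periodic_2pi g" "integral {a..a + 2 * pi} g = 0" "\<And>x. \<bar>g x\<bar> \<le> M"
  shows "\<exists>fs. fs q = g \<and> deriv_chain q fs \<and> periodic_2pi (fs 0) \<and> (\<forall>x. \<bar>fs 0 x\<bar> \<le> (2 * pi) ^ q * M)"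
  using assms
proof (induction q arbitrary: g M)
  case 0
  then show ?case by (intro exI[of _ "\<lambda>j. g"]) (auto simp: deriv_chain_def)
next
  case (Suc q)
  obtain G where G: "\<And>x. (G has_real_derivative g x) (at x)" "periodic_2pi G"
    "integral {a..a + 2 * pi} G = 0" "\<And>x. \<bar>G x\<bar> \<le> 2 * pi * M"
    using periodic_antiderivative[OF Suc.prems] by blast
  have "continuous_on UNIV G"
    using G(1) by (meson DERIV_isCont continuous_at_imp_continuous_on)
  from Suc.IH[OF this G(2-4)] obtain fs where fs: "fs q = G" "deriv_chain q fs" "periodic_2pi (fs 0)"
    "\<And>x. \<bar>fs 0 x\<bar> \<le> (2 * pi) ^ q * (2 * pi * M)"
    by blast
  have "deriv_chain (Suc q) (fs(Suc q := g))"
    using fs(1,2) G(1) by (auto simp: deriv_chain_def less_Suc_eq)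
  then show ?case
    using fs(3,4) by (intro exI[of _ "fs(Suc q := g)"] conjI) (simp_all add: mult_ac del: fun_upd_apply, simp_all)
qed

section \<open>Geometric decay against powers, and boundedness of trigonometric polynomials\<close>

text \<open>With t the m-th root of \<open>\<kappa>\<close>, the sequence is the m-th power of n
  t^n, which tends to 0; only m = 0 has no root to take.\<close>

lemma tendsto_power_times_geometric:
  fixes \<kappa> :: real
  assumes "0 \<le> \<kappa>" "\<kappa> < 1"
  shows "(\<lambda>n. real n ^ m * \<kappa> ^ n) \<longlonglongrightarrow> 0"
proof (cases "m = 0")
  case True
  then show ?thesis using LIMSEQ_power_zero[of \<kappa>] assms by simp
next
  case False
  define t where "t = root m \<kappa>"
  have t: "0 \<le> t" "t < 1" "t ^ m = \<kappa>"
    using False assms by (auto simp: t_def)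
  have "(\<lambda>n. (real n * t ^ n) ^ m) \<longlonglongrightarrow> 0 ^ m"
    using powser_times_n_limit_0[of t] t by (intro tendsto_power) auto
  moreover have "(real n * t ^ n) ^ m = real n ^ m * \<kappa> ^ n" for n
    using t(3) by (simp add: power_mult_distrib flip: power_mult) (simp add: mult.commute power_mult)
  ultimately show ?thesis using False by (simp add: power_0_left)
qed

lemma trig_poly_bounded:
  assumes "T \<in> trig_poly n"
  shows "\<exists>B. \<forall>x. \<bar>T x\<bar> \<le> B"
proof -
  obtain t where t: "\<And>x. complex_of_real (T x) * cis (real n * x) = poly t (cis x)"
    using trig_poly_cis_poly[OF assms] by blast
  have "\<bar>T x\<bar> \<le> (\<Sum>i\<le>degree t. cmod (coeff t i))" for x
  proof -
    have "\<bar>T x\<bar> = cmod (poly t (cis x))" unfolding t[symmetric] by (simp add: norm_mult)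
    then show ?thesis using cmod_poly_cis_le_sum[of t x] by simp
  qed
  then show ?thesis by blast
qed

subsection \<open>Lower bound at a single scale\<close>

text \<open>The width \<open>h n\<close> is the largest one allowed by 48 n h \<le> \<gamma> in
  \<open>local_lower_bound\<close>. The degree \<open>n\<close> is found before \<open>T\<close> and
  \<open>fs\<close>, so scales can be fixed before the function is built; the growth of
  \<open>\<epsilon>\<close> beats the constants depending on \<open>r\<close> and
  \<open>\<theta>\<close>.\<close>

lemma single_scale_lower_bound:
  fixes q d k :: nat and z r \<theta> M :: real and \<epsilon> :: "nat \<Rightarrow> real"
  assumes r: "0 < r" "r \<le> 1" and \<theta>: "\<theta> > 0" and M: "M \<ge> 0"
    and \<epsilon>: "filterlim \<epsilon> at_top sequentially"
  defines "h \<equiv> \<lambda>n::nat. (3/4) ^ Suc q / (48 * real n)"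
  shows "\<exists>n. k \<le> n \<and> 8 / r \<le> real n \<and>
    (\<forall>T fs E. T \<in> trig_poly n \<longrightarrow>
       (\<forall>x. z < x \<longrightarrow> x < z + r \<longrightarrow> 0 \<le> (deriv ^^ q) T x) \<longrightarrow>
       (\<forall>x. z - r < x \<longrightarrow> x < z \<longrightarrow> (deriv ^^ q) T x \<le> 0) \<longrightarrow>
       deriv_chain q fs \<longrightarrow> continuous_on UNIV (fs q) \<longrightarrow>
       (\<forall>x\<in>{z - r..z + r}. 0 \<le> fs q x \<and> (x - z) * fs q x \<le> h n * fs q x) \<longrightarrow>
       (\<forall>x\<in>{z..z + h n}. \<theta> * h n ^ d * bump d 0 ((x - z) / h n) \<le> fs q x) \<longrightarrow>
       (\<forall>x. \<bar>fs 0 x\<bar> \<le> M) \<longrightarrow> (\<forall>x. \<bar>fs 0 x - T x\<bar> \<le> E) \<longrightarrow>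
       real k \<le> \<epsilon> n * real n ^ (d + 2) * E)"
proof (rule local_lower_bound[OF r, where q = q and z = z])
  let ?L = "{z - r..z + r}"
  define \<gamma> :: real where "\<gamma> = (3/4) ^ Suc q"
  define \<kappa> where "\<kappa> = (1 + cos (r / 2)) / 2"
  fix A
  assume A0: "A \<ge> 0"
    and A: "\<And>n T fs h E M. \<lbrakk>T \<in> trig_poly n; 8 / r \<le> real n;
       \<And>x. z < x \<Longrightarrow> x < z + r \<Longrightarrow> 0 \<le> (deriv ^^ q) T x;
       \<And>x. z - r < x \<Longrightarrow> x < z \<Longrightarrow> (deriv ^^ q) T x \<le> 0;
       deriv_chain q fs; continuous_on UNIV (fs q);
       \<And>x. x \<in> {z - r..z + r} \<Longrightarrow> 0 \<le> fs q x \<and> (x - z) * fs q x \<le> h * fs q x;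
       48 * real n * h \<le> (3/4) ^ Suc q; \<And>x. \<bar>fs 0 x - T x\<bar> \<le> E; \<And>x. \<bar>fs 0 x\<bar> \<le> M\<rbrakk> \<Longrightarrow>
     integral {z - r..z + r} (\<lambda>x. cutoff q z r x * fs q x) \<le>
       50 * real n * A * E / (3/4) ^ Suc q + 8 * (3 * real n ^ 2) ^ q * ((1 + cos (r / 2)) / 2) ^ n * (M + E)"
  have \<gamma>: "0 < \<gamma>" "\<gamma> \<le> 1" unfolding \<gamma>_def by (auto simp del: power_Suc intro!: power_le_one)
  have "cos (r / 2) < cos 0"
    using r pi_ge_two by (intro cos_monotone_0_pi) auto
  then have \<kappa>: "0 \<le> \<kappa>" "\<kappa> < 1" unfolding \<kappa>_def using one_plus_cos_nonneg[of "r / 2"] by auto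
  \<comment> \<open>The remainder factor from \<open>local_lower_bound\<close>; it decays faster
    than any power of n.\<close>
  define \<eta> where "\<eta> = (\<lambda>n. 8 * (3 * real n ^ 2) ^ q * \<kappa> ^ n)"
  \<comment> \<open>Since n h(n) = \<gamma> / 48, the guaranteed mass of \<open>fs q\<close> is
    exactly c / n^(d + 1).\<close>
  define c where "c = \<theta> * (\<gamma> * (\<gamma> / 48) ^ Suc d * bump_mass d)"
  have c: "c > 0" unfolding c_def using \<gamma> bump_mass_pos[of d] \<theta> by simp
  \<comment> \<open>The summand 1 pays for \<eta>(n) E, which is at most n E.\<close>
  define b where "b = 50 * A / \<gamma> + 1"
  have b: "b > 0" unfolding b_def using A0 \<gamma> by (simp add: add_nonneg_pos)
  have \<eta>_lim: "(\<lambda>n. real n ^ j * \<eta> n) \<longlonglongrightarrow> 0" for j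
  proof -
    have "(\<lambda>n. 8 * 3 ^ q * (real n ^ (j + 2 * q) * \<kappa> ^ n)) \<longlonglongrightarrow> 8 * 3 ^ q * 0"
      by (intro tendsto_mult tendsto_const tendsto_power_times_geometric \<kappa>)
    moreover have "8 * 3 ^ q * (real n ^ (j + 2 * q) * \<kappa> ^ n) = real n ^ j * \<eta> n" for n
      by (simp add: \<eta>_def power_mult_distrib power_add mult_ac flip: power_mult)
    ultimately show ?thesis by simp
  qed
  have "\<forall>\<^sub>F n in sequentially. real n ^ 0 * \<eta> n < 1"
    using \<eta>_lim[of 0] by (rule order_tendstoD) simp
  \<comment> \<open>This lets the remainder containing \<open>M\<close> consume at most half of
    \<open>c\<close>; \<open>M + 1\<close> covers M = 0.\<close>
  moreover have "\<forall>\<^sub>F n in sequentially. real n ^ Suc d * \<eta> n < c / (2 * (M + 1))"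
    using \<eta>_lim[of "Suc d"] by (rule order_tendstoD) (use c M in simp)
  moreover have "\<forall>\<^sub>F n in sequentially. real k * (2 * b / c) + 1 \<le> \<epsilon> n"
    using \<epsilon> by (simp add: filterlim_at_top)
  moreover have "\<forall>\<^sub>F n in sequentially. 8 / r \<le> real n"
    using filterlim_real_sequentially by (simp add: filterlim_at_top)
  ultimately have "\<forall>\<^sub>F n in sequentially. k \<le> n \<and> 8 / r \<le> real n \<and> \<eta> n \<le> 1 \<and>
      real n ^ Suc d * \<eta> n \<le> c / (2 * (M + 1)) \<and> real k * (2 * b / c) + 1 \<le> \<epsilon> n"
    using eventually_ge_at_top[of k] by eventually_elim auto
  then obtain n where n: "k \<le> n" "8 / r \<le> real n" "\<eta> n \<le> 1"
      "real n ^ Suc d * \<eta> n \<le> c / (2 * (M + 1))" "real k * (2 * b / c) + 1 \<le> \<epsilon> n"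
    using eventually_happens trivial_limit_sequentially by blast
  have "8 / r \<ge> 8" using r by (simp add: field_simps)
  then have n8: "real n \<ge> 8" using n by linarith
  have h0: "0 < h n" unfolding h_def using n8 by simp
  have "h n \<le> 1 / (48 * real n)"
    unfolding h_def \<gamma>_def[symmetric] using \<gamma> by (intro divide_right_mono) auto
  also have "\<dots> \<le> r / 2" using n(2) r n8 by (simp add: field_simps)
  finally have hr: "h n \<le> r / 2" .
  have "real k \<le> \<epsilon> n * real n ^ (d + 2) * E"
    if T: "T \<in> trig_poly n"
      and pos: "\<forall>x. z < x \<longrightarrow> x < z + r \<longrightarrow> 0 \<le> (deriv ^^ q) T x"
      and neg: "\<forall>x. z - r < x \<longrightarrow> x < z \<longrightarrow> (deriv ^^ q) T x \<le> 0"
      and fs: "deriv_chain q fs" and cont: "continuous_on UNIV (fs q)"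
      and g: "\<forall>x\<in>{z - r..z + r}. 0 \<le> fs q x \<and> (x - z) * fs q x \<le> h n * fs q x"
      and low: "\<forall>x\<in>{z..z + h n}. \<theta> * h n ^ d * bump d 0 ((x - z) / h n) \<le> fs q x"
      and fM: "\<forall>x. \<bar>fs 0 x\<bar> \<le> M" and E: "\<forall>x. \<bar>fs 0 x - T x\<bar> \<le> E"
    for T fs E
  proof -
    define G where "G = integral ?L (\<lambda>x. cutoff q z r x * fs q x)"
    have cg: "continuous_on S (fs q)" for S using cont continuous_on_subset by blast
    have E0: "E \<ge> 0" using E[rule_format, of 0] by linarith
    have "48 * real n * h n \<le> (3/4) ^ Suc q" unfolding h_def using n8 by simp
    then have "G \<le> 50 * real n * A * E / \<gamma> + 8 * (3 * real n ^ 2) ^ q * \<kappa> ^ n * (M + E)"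
      unfolding G_def \<gamma>_def \<kappa>_def
      by (intro A[of T n fs "h n" E M] T n fs cont) (use pos neg g E fM in auto)
    then have up: "G \<le> 50 * real n * A * E / \<gamma> + \<eta> n * (M + E)" by (simp add: \<eta>_def)
    \<comment> \<open>Only the bump of width \<open>h n\<close> is kept; it lies within r / 2 of
      \<open>z\<close>, where the cutoff is at least \<open>\<gamma>\<close>.\<close>
    have "\<gamma> * (\<theta> * h n ^ d) * (h n * bump_mass d) \<le> G"
    proof (rule has_integral_le)
      let ?f = "\<lambda>x. \<gamma> * (\<theta> * h n ^ d) * bump d 0 ((x - z) / h n)"
      show "(?f has_integral \<gamma> * (\<theta> * h n ^ d) * (h n * bump_mass d)) ?L"
      proof (rule has_integral_on_superset)
        show "(?f has_integral \<gamma> * (\<theta> * h n ^ d) * (h n * bump_mass d)) {z..z + h n}"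
          by (intro has_integral_mult_right bump_scaled_has_integral h0)
        show "?f x = 0" if "x \<notin> {z..z + h n}" for x
          using that h0 bump_outside[of "(x - z) / h n"] by (auto simp: field_simps)
      qed (use hr r h0 in auto)
      show "((\<lambda>x. cutoff q z r x * fs q x) has_integral G) ?L"
        unfolding G_def by (intro integrable_integral integrable_continuous_real continuous_intros cg r)
      fix x assume x: "x \<in> ?L"
      have c0: "0 \<le> cutoff q z r x * fs q x"
        using g x cutoff_bounds[OF r(1) x] by (intro mult_nonneg_nonneg) auto
      show "?f x \<le> cutoff q z r x * fs q x"
      proof (cases "x \<in> {z..z + h n}")
        case True
        then have "\<bar>x - z\<bar> \<le> r / 2" using hr by auto
        from cutoff_ge[OF r(1) this] have "\<gamma> \<le> cutoff q z r x" by (simp add: \<gamma>_def)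
        moreover have "\<theta> * h n ^ d * bump d 0 ((x - z) / h n) \<le> fs q x" using low True by blast
        ultimately have "\<gamma> * (\<theta> * h n ^ d * bump d 0 ((x - z) / h n)) \<le> cutoff q z r x * fs q x"
          using \<gamma> \<theta> h0 bump_nonneg by (intro mult_mono) auto
        then show ?thesis by (simp add: mult.assoc)
      next
        case False
        then have "bump d 0 ((x - z) / h n) = 0"
          using h0 by (intro bump_outside) (auto simp: field_simps)
        then show ?thesis using c0 by simp
      qed
    qed
    moreover have "real n ^ Suc d * (\<gamma> * (\<theta> * h n ^ d) * (h n * bump_mass d)) = c"
    proof -
      have "real n * h n = \<gamma> / 48" unfolding h_def \<gamma>_def using n8 by simp
      then have "(\<gamma> / 48) ^ Suc d = real n ^ Suc d * h n ^ Suc d"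
        by (metis power_mult_distrib)
      then show ?thesis unfolding c_def by (simp add: mult_ac)
    qed
    ultimately have "c \<le> real n ^ Suc d * G"
      using n8 by (metis mult_left_mono of_nat_0_le_iff zero_le_power)
    also have "\<dots> \<le> real n ^ Suc d * (50 * real n * A * E / \<gamma> + \<eta> n * (M + E))"
      using up by (intro mult_left_mono) auto
    also have "\<dots> = real n ^ Suc d * (50 * real n * A * E / \<gamma>) + real n ^ Suc d * \<eta> n * M + real n ^ Suc d * (\<eta> n * E)"
      by (simp add: algebra_simps)
    also have "\<dots> \<le> real n ^ Suc d * (50 * real n * A * E / \<gamma>) + c / 2 + real n ^ Suc d * (real n * E)"
    proof -
      have "real n ^ Suc d * \<eta> n * M \<le> c / (2 * (M + 1)) * M" using n(4) M by (intro mult_right_mono) auto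
      also have "\<dots> \<le> c / 2" using c M by (simp add: field_simps)
      finally have "real n ^ Suc d * \<eta> n * M \<le> c / 2" .
      moreover have "real n ^ Suc d * (\<eta> n * E) \<le> real n ^ Suc d * (real n * E)"
        using n(3) n8 E0 by (intro mult_left_mono mult_right_mono) auto
      ultimately show ?thesis by linarith
    qed
    finally have "c / 2 \<le> real n ^ Suc d * (50 * real n * A * E / \<gamma>) + real n ^ Suc d * (real n * E)" by linarith
    also have "\<dots> = b * (real n ^ (d + 2) * E)" by (simp add: b_def field_simps)
    finally have "c / (2 * b) \<le> real n ^ (d + 2) * E" using b by (simp add: field_simps)
    moreover have "real k * (2 * b / c) \<le> \<epsilon> n" using n(5) by linarith
    ultimately have "real k * (2 * b / c) * (c / (2 * b)) \<le> \<epsilon> n * (real n ^ (d + 2) * E)"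
      using b c by (intro mult_mono) (auto intro: order.trans[of _ "real k * (2 * b / c)"])
    moreover have "real k * (2 * b / c) * (c / (2 * b)) = real k" using b c by simp
    ultimately show ?thesis by (simp add: mult.assoc)
  qed
  with n(1,2) show ?thesis by blast
qed

subsection \<open>Superposition of bumps at rapidly decreasing scales\<close>

text \<open>The bound on \<open>u p\<close> makes \<open>u (p - 1)\<close> Lipschitz with constant
  2, hence absolutely continuous.\<close>

lemma W_class_if_deriv_chain:
  assumes u: "deriv_chain p u" and "p \<ge> 1" and per: "periodic_2pi (u 0)" and bound: "\<And>x. \<bar>u p x\<bar> \<le> 2"
  shows "u 0 \<in> W_class p"
proof -
  have e: "(deriv ^^ j) (u 0) = u j" if "j \<le> p" for j
    using funpow_deriv_chain[OF u that] .
  have D: "(u (p - 1) has_real_derivative u p x) (at x)" for x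
    using deriv_chainD[OF u, of "p - 1" x] assms(2) by simp
  have lip: "\<bar>u (p - 1) v - u (p - 1) w\<bar> \<le> 2 * \<bar>v - w\<bar>" for v w
    using field_differentiable_bound[of UNIV "u (p - 1)" "u p" 2 v w] D bound by auto
  have "abs_cont_on a b (u (p - 1))" for a b
    unfolding abs_cont_on_def
  proof (intro allI impI)
    fix e :: real assume "e > 0"
    show "\<exists>d>0. \<forall>(n::nat) (v::nat \<Rightarrow> real) w. (\<forall>k<n. a \<le> v k \<and> v k \<le> w k \<and> w k \<le> b) \<and>
        (\<forall>j<n. \<forall>k<n. j \<noteq> k \<longrightarrow> w j \<le> v k \<or> w k \<le> v j) \<and> (\<Sum>k<n. w k - v k) < d \<longrightarrow>
        (\<Sum>k<n. \<bar>u (p - 1) (w k) - u (p - 1) (v k)\<bar>) < e"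
    proof (intro exI[of _ "e / 2"] conjI allI impI)
      fix n :: nat and v w :: "nat \<Rightarrow> real"
      assume vw: "(\<forall>k<n. a \<le> v k \<and> v k \<le> w k \<and> w k \<le> b) \<and>
        (\<forall>j<n. \<forall>k<n. j \<noteq> k \<longrightarrow> w j \<le> v k \<or> w k \<le> v j) \<and> (\<Sum>k<n. w k - v k) < e / 2"
      have "(\<Sum>k<n. \<bar>u (p - 1) (w k) - u (p - 1) (v k)\<bar>) \<le> (\<Sum>k<n. 2 * (w k - v k))"
      proof (rule sum_mono)
        fix k assume "k \<in> {..<n}"
        then have "v k \<le> w k" using vw by auto
        then show "\<bar>u (p - 1) (w k) - u (p - 1) (v k)\<bar> \<le> 2 * (w k - v k)"
          using lip[of "w k" "v k"] by simp
      qed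
      also have "\<dots> = 2 * (\<Sum>k<n. w k - v k)" by (simp add: sum_distrib_left)
      also have "\<dots> < e" using vw by linarith
      finally show "(\<Sum>k<n. \<bar>u (p - 1) (w k) - u (p - 1) (v k)\<bar>) < e" .
    qed (use \<open>e > 0\<close> in simp)
  qed
  moreover have "u j differentiable (at x)" if "j < p" for j x
    using deriv_chainD[OF u that] by (auto simp: real_differentiable_def)
  ultimately show ?thesis
    unfolding W_class_def using assms(2) per bound by (auto simp: e)
qed

text \<open>The index \<open>j\<close> again counts derivatives for \<open>j \<le> d\<close>: each
  one divides by \<open>h k\<close>, which the height \<open>h k ^ d\<close> can afford
  \<open>d\<close> times. The weights (1/2)^(k+1) sum to one.\<close>

definition bump_series :: "nat \<Rightarrow> real \<Rightarrow> real \<Rightarrow> (nat \<Rightarrow> real) \<Rightarrow> nat \<Rightarrow> real \<Rightarrow> real" where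
  "bump_series d z c h j x = (\<Sum>k. c * (1/2) ^ Suc k * h k ^ (d - j) * bump d j ((x - z) / h k))"

lemma bump_series:
  assumes h: "\<And>k. 0 < h k" "\<And>k. h k \<le> \<rho>" and \<rho>: "\<rho> \<le> 1" and c: "c \<ge> 0"
    and C: "\<forall>j\<le>d. \<forall>x. \<bar>bump d j x\<bar> \<le> C"
  shows "deriv_chain d (bump_series d z c h)" "continuous_on UNIV (bump_series d z c h d)"
    "\<And>j x. j \<le> d \<Longrightarrow> \<bar>bump_series d z c h j x\<bar> \<le> c * C"
    "\<And>j x. x \<le> z \<or> z + \<rho> \<le> x \<Longrightarrow> bump_series d z c h j x = 0"
    "\<And>x. 0 \<le> bump_series d z c h 0 x"
    "\<And>k x. c * (1/2) ^ Suc k * h k ^ d * bump d 0 ((x - z) / h k) \<le> bump_series d z c h 0 x"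
proof -
  define F where "F = (\<lambda>k j x. c * (1/2) ^ Suc k * h k ^ (d - j) * bump d j ((x - z) / h k))"
  have S: "bump_series d z c h = (\<lambda>j x. \<Sum>k. F k j x)"
    by (intro ext) (simp add: bump_series_def F_def)
  have h1: "h k \<le> 1" for k using h(2)[of k] \<rho> by linarith
  have C0: "C \<ge> 0" using C[rule_format, of 0 0] by auto
  have chain: "deriv_chain d (F k)" for k
    unfolding deriv_chain_def
  proof (intro allI impI)
    fix j x assume j: "j < d"
    then have "d - j = Suc (d - Suc j)" by simp
    then have "h k ^ (d - j) / h k = h k ^ (d - Suc j)" using h(1)[of k] by simp
    then have eq: "c * (1/2) ^ Suc k * h k ^ (d - j) / h k = c * (1/2) ^ Suc k * h k ^ (d - Suc j)"
      by (metis times_divide_eq_right)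
    show "(F k j has_real_derivative F k (Suc j) x) (at x)"
      unfolding F_def eq[symmetric] by (rule bump_scaled_has_derivative) (use j h(1)[of k] in auto)
  qed
  have cont: "continuous_on UNIV (F k d)" for k
    unfolding F_def
    by (intro continuous_intros continuous_on_compose2[OF bump_continuous_on[OF order.refl, of UNIV]])
       (use h(1)[of k] in auto)
  have bound: "\<bar>F k j x\<bar> \<le> c * C * (1/2) ^ Suc k" if "j \<le> d" for j k x
  proof -
    have "h k ^ (d - j) * \<bar>bump d j ((x - z) / h k)\<bar> \<le> 1 * C"
      using h(1)[of k] h1 C[rule_format, OF that] C0 by (intro mult_mono power_le_one) (auto intro: less_imp_le)
    then have "c * (1/2) ^ Suc k * (h k ^ (d - j) * \<bar>bump d j ((x - z) / h k)\<bar>) \<le> c * (1/2) ^ Suc k * (1 * C)"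
      using c by (intro mult_left_mono) auto
    then show ?thesis
      unfolding F_def using h(1)[of k] c by (simp add: abs_mult mult_ac)
  qed
  have sums: "(\<lambda>k. c * C * (1/2) ^ Suc k) sums (c * C)"
    using sums_mult[OF power_half_series, of "c * C"] by simp
  have M: "summable (\<lambda>k. c * C * (1/2) ^ Suc k)" using sums sums_summable by blast
  show "deriv_chain d (bump_series d z c h)" "continuous_on UNIV (bump_series d z c h d)"
    unfolding S using deriv_chain_suminf[OF chain cont bound M] by auto
  have sF: "summable (\<lambda>k. F k j x)" if "j \<le> d" for j x
    using bound[OF that] by (intro summable_comparison_test'[OF M]) auto
  have sFa: "summable (\<lambda>k. \<bar>F k j x\<bar>)" if "j \<le> d" for j x
    using bound[OF that] by (intro summable_comparison_test'[OF M]) auto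
  show "\<bar>bump_series d z c h j x\<bar> \<le> c * C" if "j \<le> d" for j x
  proof -
    have "\<bar>\<Sum>k. F k j x\<bar> \<le> (\<Sum>k. \<bar>F k j x\<bar>)" using sFa[OF that] by (rule summable_rabs)
    also have "\<dots> \<le> (\<Sum>k. c * C * (1/2) ^ Suc k)"
      by (intro suminf_le bound that sFa M)
    also have "\<dots> = c * C" using sums by (simp add: sums_iff)
    finally show ?thesis unfolding S .
  qed
  show "bump_series d z c h j x = 0" if x: "x \<le> z \<or> z + \<rho> \<le> x" for j x
  proof -
    have "F k j x = 0" for k
    proof -
      have "(x - z) / h k \<le> 1/2 \<or> 1 \<le> (x - z) / h k"
        using x h(1)[of k] h(2)[of k] by (auto simp: field_simps)
      then show ?thesis using bump_outside unfolding F_def by simp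
    qed
    then show ?thesis unfolding S by simp
  qed
  have F0: "0 \<le> F k 0 x" for k x
    unfolding F_def using c h(1)[of k] bump_nonneg by simp
  show "0 \<le> bump_series d z c h 0 x" for x
    unfolding S by (intro suminf_nonneg sF F0) simp
  show "c * (1/2) ^ Suc k * h k ^ d * bump d 0 ((x - z) / h k) \<le> bump_series d z c h 0 x" for k x
    using sum_le_suminf[OF sF[of 0 x], of "{k}"] F0 unfolding S by (simp add: F_def)
qed

text \<open>The q-th derivative is a bump series just right of \<open>y 1\<close> minus one
  fixed-width bump of equal mass inside (y 2, y 1), where the sign must be negative. Its mean is
  zero, so it integrates \<open>q\<close> times to a periodic function. The factor \<open>c\<close>
  is fixed before the scales \<open>h\<close>.\<close>

lemma bump_series_function:
  fixes y :: "nat \<Rightarrow> real" and q d s :: nat and \<rho> :: real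
  assumes q: "q \<ge> 2" and s: "s \<ge> 1"
    and dec: "\<forall>i. i < 2 * s \<longrightarrow> y (Suc i) < y i" and y0: "y 0 = y (2 * s) + 2 * pi"
    and \<rho>: "0 < \<rho>" "\<rho> \<le> 1" "4 * \<rho> \<le> y 1 - y 2" "4 * \<rho> \<le> y 0 - y 1"
  shows "\<exists>c>0. \<forall>h. (\<forall>k. 0 < h k \<and> h k \<le> \<rho>) \<longrightarrow>
    (\<exists>fs. deriv_chain (q + d) fs \<and> periodic_2pi (fs 0) \<and> continuous_on UNIV (fs q) \<and>
       (\<forall>x. \<bar>fs 0 x\<bar> \<le> (2 * pi) ^ q * 2) \<and> (\<forall>x. \<bar>fs (q + d) x\<bar> \<le> 2) \<and> fs 0 \<in> Delta_q q s y \<and>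
       (\<forall>x\<in>{y 1 - \<rho>..y 1 + \<rho>}. fs q x = bump_series d (y 1) c h 0 x))"
proof -
  obtain C where C: "C > 0" "\<forall>j\<le>d. \<forall>x. \<bar>bump d j x\<bar> \<le> C"
    using bump_bounded[of d] by blast
  let ?z = "y 1"
  define a where "a = y (2 * s)"
  \<comment> \<open>The compensating bump lives in (y 2 + \<rho>, y 2 + 2 \<rho>), clear of the
    neighbourhood of \<open>y 1\<close> and of the seam at \<open>a\<close>, which is
    \<open>y 2\<close> itself when s = 1.\<close>
  define z' where "z' = y 2 + \<rho>"
  \<comment> \<open>The series is at most c C and the compensating bump at most c (K - C), its mass
    being at most 2 pi c C; so c = 2 / K gives the bound 2 demanded by
    \<open>W_class\<close>.\<close>
  define K where "K = C + 2 * pi * C * C / (bump_mass d * \<rho> ^ Suc d)"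
  have K: "K > 0" unfolding K_def using C \<rho> bump_mass_pos[of d] by (intro add_pos_pos) auto
  define c where "c = 2 / K"
  have c: "c > 0" unfolding c_def using K by simp
  have mono: "y i \<le> y j" if "j \<le> i" "i \<le> 2 * s" for i j
    using that
  proof (induction i rule: dec_induct)
    case (step i)
    then show ?case using dec by (auto simp: less_eq_real_def intro: less_trans less_le_trans)
  qed simp
  have ya: "a \<le> y 2" "y 0 = a + 2 * pi" using mono[of 2 "2 * s"] s y0 by (auto simp: a_def)
  have \<rho>pi: "\<rho> \<le> pi" using \<rho> pi_ge_two by linarith
  show ?thesis
  proof (intro exI[of _ c] conjI allI impI c)
    fix h :: "nat \<Rightarrow> real" assume "\<forall>k. 0 < h k \<and> h k \<le> \<rho>"
    then have h: "\<And>k. 0 < h k" "\<And>k. h k \<le> \<rho>" by auto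
    define S where "S = bump_series d ?z c h"
    note S = bump_series[where h = h and z = ?z, OF h \<rho>(2) less_imp_le[OF c] C(2), folded S_def]
    have cS: "continuous_on X (S 0)" for X
      using S(2) deriv_chain_continuous_on[OF S(1), of 0] continuous_on_subset by (cases "d = 0") auto
    define m where "m = integral {a..a + 2 * pi} (S 0)"
    have m0: "0 \<le> m" unfolding m_def by (intro integral_nonneg integrable_continuous_real cS S(5))
    have m1: "m \<le> 2 * pi * (c * C)"
    proof -
      have "m \<le> integral {a..a + 2 * pi} (\<lambda>x. c * C)"
        unfolding m_def using S(3)[of 0] by (intro integral_le integrable_continuous_real cS) (auto simp: abs_le_iff)
      then show ?thesis by (simp add: mult_ac)
    qed
    \<comment> \<open>A bump of width \<open>\<rho>\<close> has mass
      \<open>\<rho> * bump_mass d\<close>, so \<open>B 0\<close> has mass \<open>m\<close>; the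
      further factors of 1 / \<rho> come from the chain rule.\<close>
    define B where "B = (\<lambda>j x. m / bump_mass d / \<rho> ^ Suc j * bump d j ((x - z') / \<rho>))"
    have B: "deriv_chain d B"
      unfolding deriv_chain_def
    proof (intro allI impI)
      fix j x assume "j < d"
      then show "(B j has_real_derivative B (Suc j) x) (at x)"
        using bump_scaled_has_derivative[of j d \<rho> "m / bump_mass d / \<rho> ^ Suc j" z' x] \<rho>(1)
        by (simp add: B_def mult_ac)
    qed
    have Bc: "continuous_on UNIV (B d)"
      unfolding B_def
      by (intro continuous_intros continuous_on_compose2[OF bump_continuous_on[OF order.refl, of UNIV]])
         (use \<rho>(1) in auto)
    have B0: "B j x = 0" if x: "x \<le> z' \<or> z' + \<rho> \<le> x" for j x
    proof -
      have "(x - z') / \<rho> \<le> 1/2 \<or> 1 \<le> (x - z') / \<rho>"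
        using x \<rho>(1) by (auto simp: field_simps)
      then show ?thesis using bump_outside unfolding B_def by simp
    qed
    have Bpos: "0 \<le> B 0 x" for x
      unfolding B_def using m0 \<rho>(1) bump_mass_pos[of d] bump_nonneg by simp
    have Bb: "\<bar>B j x\<bar> \<le> c * (K - C)" if "j \<le> d" for j x
    proof -
      have "\<rho> ^ Suc d \<le> \<rho> ^ Suc j" using \<rho> that by (intro power_decreasing) auto
      then have "m / bump_mass d / \<rho> ^ Suc j \<le> m / bump_mass d / \<rho> ^ Suc d"
        using \<rho>(1) m0 bump_mass_pos[of d] by (intro divide_left_mono) auto
      also have "\<dots> \<le> 2 * pi * (c * C) / bump_mass d / \<rho> ^ Suc d"
        using m1 \<rho>(1) bump_mass_pos[of d] by (intro divide_right_mono) auto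
      finally have "m / bump_mass d / \<rho> ^ Suc j * \<bar>bump d j ((x - z') / \<rho>)\<bar> \<le>
          2 * pi * (c * C) / bump_mass d / \<rho> ^ Suc d * C"
        using C \<rho>(1) c bump_mass_pos[of d] that by (intro mult_mono) (auto intro!: divide_nonneg_nonneg mult_nonneg_nonneg simp: less_imp_le)
      moreover have "2 * pi * (c * C) / bump_mass d / \<rho> ^ Suc d * C = c * (K - C)"
        by (simp add: K_def mult_ac)
      moreover have "\<bar>B j x\<bar> = m / bump_mass d / \<rho> ^ Suc j * \<bar>bump d j ((x - z') / \<rho>)\<bar>"
        unfolding B_def abs_mult using m0 \<rho>(1) bump_mass_pos[of d] by simp
      ultimately show ?thesis by simp
    qed
    define F where "F = (\<lambda>j x. S j x - B j x)"
    have F: "deriv_chain d F" unfolding F_def by (intro deriv_chain_diff S B)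
    have Fc: "continuous_on UNIV (F d)" unfolding F_def by (intro continuous_intros S(2) Bc)
    have Fb: "\<bar>F j x\<bar> \<le> 2" if "j \<le> d" for j x
    proof -
      have "\<bar>F j x\<bar> \<le> c * C + c * (K - C)"
        unfolding F_def using S(3)[OF that, of x] Bb[OF that, of x] by linarith
      also have "\<dots> = 2" using K by (simp add: c_def field_simps)
      finally show ?thesis .
    qed
    have F0: "F j t = 0" if t: "t \<le> a + \<rho> \<or> a + 2 * pi - \<rho> \<le> t" for j t
    proof -
      have "S j t = 0" by (rule S(4)) (use t ya \<rho> in linarith)
      moreover have "B j t = 0" by (rule B0) (use t ya \<rho> in \<open>unfold z'_def, linarith\<close>)
      ultimately show ?thesis by (simp add: F_def)
    qed
    define g where "g = (\<lambda>j. periodise a (F j))"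
    have g: "deriv_chain d g"
      unfolding g_def by (rule periodise_deriv_chain[OF \<rho>(1) \<rho>pi F0 F])
    have gc: "continuous_on UNIV (g d)"
      unfolding g_def by (rule periodise_continuous_on[OF \<rho>(1) \<rho>pi F0 Fc])
    have gc0: "continuous_on UNIV (g 0)"
      using gc deriv_chain_continuous_on[OF g, of 0] by (cases "d = 0") auto
    \<comment> \<open>The right end is included because \<open>F\<close> vanishes at both ends of
      the period.\<close>
    have gF: "g j x = F j x" if "a \<le> x" "x \<le> a + 2 * pi" for j x
    proof (cases "x = a + 2 * pi")
      case True
      have "periodise a (F j) (a + 2 * pi) = periodise a (F j) a"
        using periodise_periodic[of a "F j"] by (simp add: periodic_2pi_def)
      also have "\<dots> = F j a" by (rule periodise_eq) auto
      finally show ?thesis using True F0[of a j] F0[of "a + 2 * pi" j] \<rho>(1) by (simp add: g_def)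
    next
      case False
      then show ?thesis unfolding g_def using that by (intro periodise_eq) auto
    qed
    have gb: "\<bar>g j x\<bar> \<le> 2" if "j \<le> d" for j x
      unfolding g_def periodise_def by (rule Fb[OF that])
    have mean: "integral {a..a + 2 * pi} (g 0) = 0"
    proof -
      have "(B 0 has_integral m / bump_mass d / \<rho> ^ Suc 0 * (\<rho> * bump_mass d)) {a..a + 2 * pi}"
      proof (rule has_integral_on_superset)
        show "(B 0 has_integral m / bump_mass d / \<rho> ^ Suc 0 * (\<rho> * bump_mass d)) {z'..z' + \<rho>}"
          unfolding B_def by (intro has_integral_mult_right bump_scaled_has_integral \<rho>)
        show "{z'..z' + \<rho>} \<subseteq> {a..a + 2 * pi}" using ya \<rho> by (auto simp: z'_def)
      qed (use B0 in auto)
      moreover have "m / bump_mass d / \<rho> ^ Suc 0 * (\<rho> * bump_mass d) = m"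
        using \<rho>(1) bump_mass_pos[of d] by simp
      moreover have "(S 0 has_integral m) {a..a + 2 * pi}"
        unfolding m_def by (intro integrable_integral integrable_continuous_real cS)
      ultimately have "(F 0 has_integral m - m) {a..a + 2 * pi}"
        unfolding F_def by (intro has_integral_diff) auto
      then have "integral {a..a + 2 * pi} (F 0) = 0" by (simp add: integral_unique)
      moreover have "integral {a..a + 2 * pi} (g 0) = integral {a..a + 2 * pi} (F 0)"
        by (rule integral_cong) (use gF in auto)
      ultimately show ?thesis by simp
    qed
    have "periodic_2pi (g 0)" unfolding g_def by (rule periodise_periodic)
    from periodic_iterated_antiderivative[OF gc0 this mean gb, of q]
    obtain us where us: "us q = g 0" "deriv_chain q us" "periodic_2pi (us 0)"
      "\<And>x. \<bar>us 0 x\<bar> \<le> (2 * pi) ^ q * 2"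
      by auto
    \<comment> \<open>Antiderivatives of \<open>g 0\<close> up to order \<open>q\<close>,
      derivatives of \<open>g 0\<close> beyond; the two agree at order \<open>q\<close>.\<close>
    define fs where "fs = (\<lambda>j. if j \<le> q then us j else g (j - q))"
    have fs: "deriv_chain (q + d) fs"
      unfolding deriv_chain_def
    proof (intro allI impI)
      fix j x assume j: "j < q + d"
      consider "j < q" | "j = q" | "q < j" by linarith
      then show "(fs j has_real_derivative fs (Suc j) x) (at x)"
      proof cases
        case 1
        then show ?thesis using deriv_chainD[OF us(2)] by (simp add: fs_def)
      next
        case 2
        then show ?thesis using deriv_chainD[OF g, of 0 x] j us(1) by (simp add: fs_def)
      next
        case 3
        then show ?thesis using deriv_chainD[OF g, of "j - q" x] j by (simp add: fs_def Suc_diff_le)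
      qed
    qed
    have fsq: "fs q = g 0" using us by (simp add: fs_def)
    have fsqd: "fs (q + d) = g d" using us by (cases "d = 0") (auto simp: fs_def)
    have "fs 0 \<in> Delta_q q s y"
      unfolding Delta_q_def
    proof (intro CollectI conjI allI impI)
      show "continuous_on UNIV (fs 0)" using deriv_chain_continuous_on[OF fs, of 0] q by simp
      show "periodic_2pi (fs 0)" using us by (simp add: fs_def)
      fix i assume i: "1 \<le> i \<and> i \<le> 2 * s"
      have "deriv_chain q (\<lambda>j x. (-1) ^ (i - 1) * fs j x)"
        by (intro deriv_chain_cmult deriv_chain_mono[OF fs]) simp
      then show "q_monotone_on q (y i) (y (i - 1)) (\<lambda>x. (-1) ^ (i - 1) * fs 0 x)"
      proof (rule q_monotone_on_if_deriv_chain[OF _ q])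
        fix x assume x: "y i < x" "x < y (i - 1)"
        have "a \<le> y i" "y (i - 1) \<le> y 0" using i mono by (auto simp: a_def)
        then have e: "fs q x = F 0 x" using x ya by (simp add: fsq gF)
        \<comment> \<open>Only the two intervals adjacent to \<open>y 1\<close> meet a support: the
          series lives in the first, the compensating bump in the second.\<close>
        consider "i = 1" | "i = 2" | "i \<ge> 3" using i by linarith
        then show "0 \<le> (-1) ^ (i - 1) * fs q x"
        proof cases
          case 1
          then have "B 0 x = 0" using x \<rho> by (intro B0) (auto simp: z'_def)
          then show ?thesis using 1 S(5)[of x] by (simp add: e F_def)
        next
          case 2
          then have "S 0 x = 0" using x by (intro S(4)) auto
          then show ?thesis using 2 Bpos[of x] by (simp add: e F_def)
        next
          case 3
          then have "y (i - 1) \<le> y 2" using i by (intro mono) auto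
          then have "S 0 x = 0" "B 0 x = 0" using x \<rho> by (auto intro!: S(4) B0 simp: z'_def)
          then show ?thesis by (simp add: e F_def)
        qed
      qed
    qed
    moreover have "fs q x = S 0 x" if "x \<in> {?z - \<rho>..?z + \<rho>}" for x
    proof -
      have "B 0 x = 0" using that \<rho> by (intro B0) (auto simp: z'_def)
      moreover have "fs q x = F 0 x" unfolding fsq using that \<rho> ya by (intro gF) auto
      ultimately show ?thesis by (simp add: F_def)
    qed
    ultimately show "\<exists>fs. deriv_chain (q + d) fs \<and> periodic_2pi (fs 0) \<and> continuous_on UNIV (fs q) \<and>
       (\<forall>x. \<bar>fs 0 x\<bar> \<le> (2 * pi) ^ q * 2) \<and> (\<forall>x. \<bar>fs (q + d) x\<bar> \<le> 2) \<and> fs 0 \<in> Delta_q q s y \<and>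
       (\<forall>x\<in>{?z - \<rho>..?z + \<rho>}. fs q x = bump_series d ?z c h 0 x)"
      using fs us gc0 gb[of d] by (intro exI[of _ fs]) (auto simp: fsq fsqd S_def, auto simp: fs_def)
  qed
qed

section \<open>From estimates at selected degrees to the limit superior\<close>

lemma limsup_eq_infinityI:
  assumes "\<And>k::nat. \<exists>n\<ge>k. ereal (real k) \<le> X n"
  shows "limsup X = \<infinity>"
proof (rule ereal_top)
  fix B :: real
  have "ereal B \<le> (SUP m\<in>{n..}. X m)" for n
  proof -
    define k where "k = max n (nat \<lceil>B\<rceil>)"
    obtain m where m: "m \<ge> k" "ereal (real k) \<le> X m" using assms by blast
    have "B \<le> real k" unfolding k_def by linarith
    then have "ereal B \<le> X m" using m(2) by (meson ereal_less_eq(3) order.trans)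
    moreover have "m \<in> {n..}" using m(1) by (simp add: k_def)
    ultimately show ?thesis by (meson SUP_upper2)
  qed
  then show "ereal B \<le> limsup X" unfolding limsup_INF_SUP by (intro INF_greatest) auto
qed

text \<open>Reduces the infimum of suprema to pointwise error bounds \<open>E\<close>. Boundedness
  of \<open>f\<close> and \<open>T\<close> makes the real supremum in \<open>sup_norm\<close> a
  genuine upper bound.\<close>

lemma E_q_ge:
  assumes "q \<ge> 2" "\<And>x. \<bar>f x\<bar> \<le> M"
    and "\<And>T E. \<lbrakk>T \<in> trig_poly n; T \<in> Delta_q q s y; \<And>x. \<bar>f x - T x\<bar> \<le> E\<rbrakk> \<Longrightarrow> L \<le> E"
  shows "L \<le> E_q q s y n f"
  unfolding E_q_def
proof (rule cINF_greatest)
  show "trig_poly n \<inter> Delta_q q s y \<noteq> {}"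
    using zero_in_trig_poly zero_in_Delta_q[OF assms(1)] by blast
  fix T assume T: "T \<in> trig_poly n \<inter> Delta_q q s y"
  then obtain B where B: "\<And>x. \<bar>T x\<bar> \<le> B" using trig_poly_bounded by blast
  have "\<bar>f x - T x\<bar> \<le> M + B" for x using assms(2)[of x] B[of x] by linarith
  then have "bdd_above (range (\<lambda>x. \<bar>f x - T x\<bar>))" by (intro bdd_aboveI) auto
  then have "\<bar>f x - T x\<bar> \<le> sup_norm (\<lambda>x. f x - T x)" for x
    unfolding sup_norm_def by (intro cSUP_upper) auto
  then show "L \<le> sup_norm (\<lambda>x. f x - T x)" using T by (intro assms(3)) auto
qed

lemma Delta_q_trig_poly_sign:
  assumes T: "T \<in> trig_poly n" "T \<in> Delta_q q s y" and "q \<ge> 2" "s \<ge> 1"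
  shows "y 1 < x \<Longrightarrow> x < y 0 \<Longrightarrow> 0 \<le> (deriv ^^ q) T x"
    and "y 2 < x \<Longrightarrow> x < y 1 \<Longrightarrow> (deriv ^^ q) T x \<le> 0"
proof -
  have mono: "0 \<le> (-1) ^ (i - 1) * (deriv ^^ q) T x"
    if "1 \<le> i" "i \<le> 2 * s" "y i < x" "x < y (i - 1)" for i x
    by (rule q_monotone_on_imp_deriv_nonneg[OF deriv_chain_cmult[OF trig_poly_deriv_chain[OF T(1)]]])
       (use that T(2) assms(3) in \<open>auto simp: Delta_q_def\<close>)
  show "0 \<le> (deriv ^^ q) T x" if "y 1 < x" "x < y 0"
    using mono[of 1 x] that assms(4) by simp
  show "(deriv ^^ q) T x \<le> 0" if "y 2 < x" "x < y 1"
    using mono[of 2 x] that assms(4) by simp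
qed

text \<open>Bumps of index below \<open>k\<close> start at distance at least \<open>R k\<close> from
  \<open>z\<close>, and those of index from \<open>k\<close> on end at distance at most
  \<open>h k\<close>. Hence within radius \<open>R k\<close> the series vanishes beyond distance
  \<open>h k\<close>.\<close>

lemma nested_bump_series:
  assumes R: "\<And>k. R (Suc k) = h k / 2" "\<And>k. 0 < h k" "\<And>k. h k \<le> R k" and x: "x \<le> z + R k"
    and nonneg: "0 \<le> bump_series d z c h 0 x"
  shows "(x - z) * bump_series d z c h 0 x \<le> h k * bump_series d z c h 0 x"
proof (cases "x - z \<le> h k")
  case True
  then show ?thesis using nonneg by (intro mult_right_mono)
next
  case False
  have R_dec: "R j \<le> R i" if "i \<le> j" for i j
  proof (rule lift_Suc_antimono_le[OF _ that])
    show "R (Suc i) \<le> R i" for i using R(1)[of i] R(2)[of i] R(3)[of i] by linarith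
  qed
  have "bump d 0 ((x - z) / h j) = 0" for j
  proof (rule bump_outside)
    show "(x - z) / h j \<le> 1/2 \<or> 1 \<le> (x - z) / h j"
    proof (cases "j < k")
      case True
      then have "x - z \<le> h j / 2" using x R_dec[of "Suc j" k] R(1)[of j] by linarith
      then show ?thesis using R(2)[of j] by (simp add: field_simps)
    next
      case False
      have "h j \<le> h k"
      proof (cases "j = k")
        case False
        then have "R j \<le> R (Suc k)" using \<open>\<not> j < k\<close> by (intro R_dec) simp
        then show ?thesis using R(1)[of k] R(2)[of k] R(3)[of j] by linarith
      qed simp
      then have "h j \<le> x - z" using \<open>\<not> x - z \<le> h k\<close> by linarith
      then show ?thesis using R(2)[of j] by (simp add: field_simps)
    qed
  qed
  then have "bump_series d z c h 0 x = 0" by (simp add: bump_series_def)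
  then show ?thesis by simp
qed

theorem theorem1p6:
  fixes q p s :: nat and y :: "nat \<Rightarrow> real" and \<epsilon> :: "nat \<Rightarrow> real"
  assumes "q \<ge> 3" and "p \<ge> q" and "s \<ge> 1"
    and "\<forall>i. i < 2 * s \<longrightarrow> y (Suc i) < y i"
    and "y 0 = y (2 * s) + 2 * pi"
    and "\<forall>n\<ge>1. \<epsilon> n > 0"
    and "filterlim \<epsilon> at_top sequentially"
  shows "\<exists>f\<in>Delta_q q s y \<inter> W_class p.
           limsup (\<lambda>n. ereal (\<epsilon> n * real n ^ (p - q + 2) * E_q q s y n f)) = \<infinity>"
proof -
  define d where "d = p - q"
  have p: "p = q + d" using assms(2) by (simp add: d_def)
  have q: "q \<ge> 2" using assms(1) by simp
  define z where "z = y 1"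
  have y10: "y 1 < y 0" "y 2 < y 1" using assms(3,4) by (auto simp: numeral_2_eq_2)
  define \<rho> where "\<rho> = min 1 (min ((y 1 - y 2) / 4) ((y 0 - y 1) / 4))"
  have \<rho>: "0 < \<rho>" "\<rho> \<le> 1" "4 * \<rho> \<le> y 1 - y 2" "4 * \<rho> \<le> y 0 - y 1"
    using y10 by (auto simp: \<rho>_def min_def)
  obtain c where c: "c > 0" and construction: "\<forall>h. (\<forall>k. 0 < h k \<and> h k \<le> \<rho>) \<longrightarrow>
    (\<exists>fs. deriv_chain (q + d) fs \<and> periodic_2pi (fs 0) \<and> continuous_on UNIV (fs q) \<and>
       (\<forall>x. \<bar>fs 0 x\<bar> \<le> (2 * pi) ^ q * 2) \<and> (\<forall>x. \<bar>fs (q + d) x\<bar> \<le> 2) \<and> fs 0 \<in> Delta_q q s y \<and>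
       (\<forall>x\<in>{z - \<rho>..z + \<rho>}. fs q x = bump_series d z c h 0 x))"
    using bump_series_function[OF q assms(3-5) \<rho>, of d] unfolding z_def by auto
  \<comment> \<open>This bound on \<open>fs 0\<close> holds for every admissible \<open>h\<close>,
    so all degrees can be selected before \<open>h\<close> and \<open>fs\<close> are known.\<close>
  define M where "M = (2 * pi) ^ q * (2::real)"
  have M: "M \<ge> 0" by (simp add: M_def)
  define \<theta> where "\<theta> = (\<lambda>k. c * (1/2) ^ Suc k)"
  have \<theta>: "\<theta> k > 0" for k using c by (simp add: \<theta>_def)
  define H where "H = (\<lambda>n::nat. (3/4) ^ Suc q / (48 * real n))"
  \<comment> \<open>The conclusion of \<open>single_scale_lower_bound\<close> for radius
    \<open>r\<close>, with \<open>k\<close> serving both as the value to be exceeded and as the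
    index of the weight \<open>\<theta> k\<close>.\<close>
  define good where "good = (\<lambda>k r n. k \<le> n \<and> 8 / r \<le> real n \<and>
    (\<forall>T fs E. T \<in> trig_poly n \<longrightarrow>
       (\<forall>x. z < x \<longrightarrow> x < z + r \<longrightarrow> 0 \<le> (deriv ^^ q) T x) \<longrightarrow>
       (\<forall>x. z - r < x \<longrightarrow> x < z \<longrightarrow> (deriv ^^ q) T x \<le> 0) \<longrightarrow>
       deriv_chain q fs \<longrightarrow> continuous_on UNIV (fs q) \<longrightarrow>
       (\<forall>x\<in>{z - r..z + r}. 0 \<le> fs q x \<and> (x - z) * fs q x \<le> H n * fs q x) \<longrightarrow>
       (\<forall>x\<in>{z..z + H n}. \<theta> k * H n ^ d * bump d 0 ((x - z) / H n) \<le> fs q x) \<longrightarrow>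
       (\<forall>x. \<bar>fs 0 x\<bar> \<le> M) \<longrightarrow> (\<forall>x. \<bar>fs 0 x - T x\<bar> \<le> E) \<longrightarrow>
       real k \<le> \<epsilon> n * real n ^ (d + 2) * E))"
  have ex_good: "\<exists>n. good k r n" if "0 < r" "r \<le> 1" for k r
    unfolding good_def H_def using single_scale_lower_bound[OF that \<theta> M assms(7)] .
  define N where "N = (\<lambda>k r. SOME n. good k r n)"
  have N: "good k r (N k r)" if "0 < r" "r \<le> 1" for k r
    unfolding N_def using ex_good[OF that] by (rule someI_ex)
  \<comment> \<open>The next radius is half the current bump width, the inner edge of that bump; all
    earlier bumps vanish inside it, so the next degree depends on them only through this
    radius.\<close>
  define R where "R = rec_nat \<rho> (\<lambda>k r. H (N k r) / 2)"
  define h where "h = (\<lambda>k. H (N k (R k)))"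
  have R0: "R 0 = \<rho>" and RS: "R (Suc k) = h k / 2" for k by (simp_all add: R_def h_def)
  have HR: "0 < H n \<and> H n \<le> r / 2" if "8 / r \<le> real n" "0 < r" "r \<le> 1" for n r
  proof -
    have "8 / r > 0" using that by simp
    then have n: "real n > 0" using that by linarith
    have "(3/4) ^ Suc q \<le> (1::real)" by (intro power_le_one) auto
    then have "H n \<le> 1 / (48 * real n)" unfolding H_def using n by (intro divide_right_mono) auto
    also have "\<dots> \<le> r / 2" using n that by (simp add: field_simps)
    finally show ?thesis using n by (simp add: H_def)
  qed
  have Rk: "0 < R k \<and> R k \<le> \<rho>" for k
  proof (induction k)
    case (Suc k)
    then have r: "0 < R k" "R k \<le> 1" using \<rho>(2) by auto
    then have "8 / R k \<le> real (N k (R k))" using N[OF r] by (simp add: good_def)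
    from HR[OF this r] show ?case using Suc by (auto simp: RS h_def)
  qed (use \<rho> in \<open>simp add: R0\<close>)
  have Rk1: "0 < R k" "R k \<le> 1" for k using Rk[of k] \<rho>(2) by auto
  have good: "good k (R k) (N k (R k))" for k using N[OF Rk1] .
  have hk: "0 < h k \<and> h k \<le> R k / 2" for k
    unfolding h_def using good[of k] by (intro HR Rk1) (simp add: good_def)
  have h0: "0 < h k" for k using hk[of k] by blast
  have hR: "h k \<le> R k" for k using hk[of k] Rk[of k] by linarith
  have h\<rho>: "h k \<le> \<rho>" for k using hR[of k] Rk[of k] by linarith
  obtain fs where fs: "deriv_chain (q + d) fs" "periodic_2pi (fs 0)" "continuous_on UNIV (fs q)"
       "\<forall>x. \<bar>fs 0 x\<bar> \<le> M" "\<forall>x. \<bar>fs (q + d) x\<bar> \<le> 2" "fs 0 \<in> Delta_q q s y"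
       "\<forall>x\<in>{z - \<rho>..z + \<rho>}. fs q x = bump_series d z c h 0 x"
    using construction[rule_format, of h] h0 h\<rho> unfolding M_def by auto
  obtain C where C: "\<forall>j\<le>d. \<forall>x. \<bar>bump d j x\<bar> \<le> C"
    using bump_bounded[of d] by blast
  note S = bump_series[where h = h and z = z, OF h0 h\<rho> \<rho>(2) less_imp_le[OF c] C]
  have "fs 0 \<in> W_class p"
    unfolding p using fs q by (intro W_class_if_deriv_chain) auto
  moreover have "limsup (\<lambda>n. ereal (\<epsilon> n * real n ^ (p - q + 2) * E_q q s y n (fs 0))) = \<infinity>"
  proof (rule limsup_eq_infinityI)
    fix k :: nat
    define n where "n = N k (R k)"
    have hn: "H n = h k" by (simp add: n_def h_def)
    have gd: "good k (R k) n" unfolding n_def by (rule good)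
    then have n: "k \<le> n" "8 / R k \<le> real n" by (auto simp: good_def)
    \<comment> \<open>Positivity of \<open>\<epsilon>\<close> is available only from index 1
      on.\<close>
    have "8 / R k > 0" using Rk1 by simp
    then have n0: "n \<ge> 1" using n(2) by linarith
    have b: "\<epsilon> n * real n ^ (d + 2) > 0" using assms(6) n0 by simp
    have sub: "{z - R k..z + R k} \<subseteq> {z - \<rho>..z + \<rho>}" using Rk[of k] by auto
    have "real k / (\<epsilon> n * real n ^ (d + 2)) \<le> E_q q s y n (fs 0)"
    proof (rule E_q_ge[OF q fs(4)[rule_format]])
      fix T E assume T: "T \<in> trig_poly n" "T \<in> Delta_q q s y" and E: "\<And>x. \<bar>fs 0 x - T x\<bar> \<le> E"
      have "real k \<le> \<epsilon> n * real n ^ (d + 2) * E"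
      proof (rule conjunct2[OF conjunct2[OF gd[unfolded good_def]], rule_format, of T fs E])
        show "0 \<le> (deriv ^^ q) T x" if "z < x" "x < z + R k" for x
          using Delta_q_trig_poly_sign(1)[OF T q assms(3)] that Rk[of k] \<rho> by (simp add: z_def)
        show "(deriv ^^ q) T x \<le> 0" if "z - R k < x" "x < z" for x
          using Delta_q_trig_poly_sign(2)[OF T q assms(3)] that Rk[of k] \<rho> by (simp add: z_def)
        show "deriv_chain q fs" by (rule deriv_chain_mono[OF fs(1)]) simp
        \<comment> \<open>The separation of scales enters here: inside radius \<open>R k\<close> all
          the mass of \<open>fs q\<close> lies within distance \<open>h k\<close> of
          \<open>z\<close>.\<close>
        show "0 \<le> fs q x \<and> (x - z) * fs q x \<le> H n * fs q x" if "x \<in> {z - R k..z + R k}" for x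
        proof -
          have "fs q x = bump_series d z c h 0 x" using fs(7) that sub by blast
          then show ?thesis
            unfolding hn using S(5)[of x] nested_bump_series[of R h x z k d c, OF RS h0 hR _ S(5)] that by simp
        qed
        \<comment> \<open>All terms of the series are nonnegative, so the k-th one alone is a lower
          bound.\<close>
        show "\<theta> k * H n ^ d * bump d 0 ((x - z) / H n) \<le> fs q x" if "x \<in> {z..z + H n}" for x
        proof -
          have "x \<in> {z - \<rho>..z + \<rho>}" using that h\<rho>[of k] \<rho>(1) unfolding hn by auto
          then have "fs q x = bump_series d z c h 0 x" using fs(7) by blast
          then show ?thesis unfolding hn \<theta>_def using S(6)[of k x] by simp
        qed
      qed (use T E fs(3,4) in auto)
      then show "real k / (\<epsilon> n * real n ^ (d + 2)) \<le> E" using b by (simp add: divide_le_eq mult_ac)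
    qed
    then have "real k \<le> \<epsilon> n * real n ^ (d + 2) * E_q q s y n (fs 0)"
      using b by (simp add: divide_le_eq mult_ac)
    then show "\<exists>n\<ge>k. ereal (real k) \<le> ereal (\<epsilon> n * real n ^ (p - q + 2) * E_q q s y n (fs 0))"
      using n(1) by (intro exI[of _ n]) (simp add: d_def)
  qed
  ultimately show ?thesis using fs(6) by blast
qed

end
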